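(* Let $(M,g_0)$ be a totally geodesic lightlike hypersurface of an $(n+2)$-dimensional Lorentzian manifold, with conformal structure $c=[g_0]_0$ and integrable screen distribution $S(TM)$, and let $D$ be a Weyl screen structure on $(M,c,S(TM))$. For $g\in c$, the Ricci curvature of $D$ is given by $$\begin{aligned}\mathrm{Ric}^D(X,Y)={}&\mathrm{Ric}^g(X,Y)-2d\theta_g(X,Y)+(1-n)(D^g_X\theta_g)(Y)+(n-1)\theta_g(X)\theta_g(Y)\\&+(1-n)g(X,Y)|\theta_g^{\sharp_g}|_g^2-g(X,Y)\delta^g\theta_g\\&+\Big([(D^g_XS)(\xi,Y)-(D^g_\xi S)(X,Y)]+g(X,Y)S(\xi,\theta_g^{\sharp_g})\\&\quad-S(\xi,X)S(\xi,Y)+\varphi_g(X)S(\xi,Y)\Big).\end{aligned}$$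
   Context: $M$ is a hypersurface of $(\bar M,\bar g)$ whose induced metric $g_0$ has constant rank $n$; $TM^\perp=\mathrm{Rad}\,TM=\ker g_0$ has nowhere vanishing (local) section $\xi$. A screen distribution $S(TM)$ is a complement of $TM^\perp$ in $TM$; $P:TM\to S(TM)$ is the projection along $TM^\perp$. $\eta$ is the 1-form with $\eta(\xi)=1$, $\ker\eta=S(TM)$. Totally geodesic: $\bar g(\bar\nabla_XY,\xi)=0$ for all $X,Y$ tangent to $M$. $c=[g_0]_0$ is the set of metrics $g=e^{-2f}g_0$ with $X(f)=0$ for $X\in TM^\perp$. A Weyl structure on $(M,c)$ is a torsion-free connection $D$ such that for each $g\in c$ there is a unique 1-form $\theta_g$ with $Dg=-2\theta_g\otimes g$; it is a Weyl screen structure relative to $(M,c,S(TM))$ if $D_XPY\in\Gamma(S(TM))$ for all $X,Y\in\Gamma(TM)$; then $\theta_g(\xi)=0$. The section $\xi$ is normalised so that $D_\xi\xi=0$, and for $g\in c$, $D^g$ is the torsion-free connection with $D^gg=0$, $D^g_\xi\xi=0$ and $$D_XY=D^g_XY+\theta_g(X)Y+\theta_g(Y)X-g(X,Y)\theta_g^{\sharp_g}-S(X,Y)\xi,$$ where $S$ is the symmetric $(0,2)$-tensor with $S(\xi,\xi)=0$ and $S(X,Y)=C(X,Y)+\eta(X)\theta_g(Y)$ for $X\in\Gamma(TM)$, $Y\in\Gamma(S(TM))$; $C$ is defined by $D^g_XPY=\overset{\star}{\nabla}_XPY+C(X,PY)\xi$ with $\overset{\star}{\nabla}_XPY\in\Gamma(S(TM))$;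 $\varphi_g$ is defined by $D^g_X\xi=\varphi_g(X)\xi$. $\tilde g(X,Y)=g(X,Y)+\eta(X)\eta(Y)$ is nondegenerate, $g^{[\alpha\beta]}$ its inverse; $\omega^{\sharp_g}$ is the vector field with $\tilde g(\omega^{\sharp_g},\cdot)=\omega$; $|X|_g^2=g(X,X)$; $\delta^g\theta_g=\mathrm{div}^g\theta_g^{\sharp_g}$ with $\mathrm{div}^gX=\sum g^{[\alpha\beta]}\tilde g(D^g_{X_\alpha}X,X_\beta)$ for a local frame $(X_\alpha)$. Curvature of a connection $\nabla$: $R^\nabla(X,Y)=\nabla_{[X,Y]}-[\nabla_X,\nabla_Y]$; $\mathrm{Ric}^\nabla(X,Y)$ is the trace of $Z\mapsto R^\nabla(X,Z)Y$; $\mathrm{Ric}^g$ is the Ricci tensor of $D^g$. Convention: $d\omega(X,Y)=\frac12[X\omega(Y)-Y\omega(X)-\omega([X,Y])]$. *)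

theory Defs
  imports "HOL-Analysis.Analysis" "HOL-Library.Function_Algebras"
begin

section \<open>Pointwise vector space structure on functions\<close>

text \<open>Tangent vectors and vector fields are represented by functions below; they are added and
  scaled pointwise.\<close>

instantiation "fun" :: (type, real_vector) real_vector
begin

definition scaleR_fun_def: "scaleR r f = (\<lambda>x. r *\<^sub>R f x)"

instance
  by standard (simp_all add: scaleR_fun_def fun_eq_iff scaleR_add_right scaleR_add_left)

end

section \<open>Smooth manifolds\<close>

text \<open>\<open>Ck_on k S f\<close> is meant for open \<open>S\<close>: \<open>f\<close> is \<open>k\<close> times continuously differentiable.\<close>

primrec Ck_on :: "nat \<Rightarrow> 'e::euclidean_space set \<Rightarrow> ('e \<Rightarrow> 'f::real_normed_vector) \<Rightarrow> bool" where
  "Ck_on 0 S f \<longleftrightarrow> continuous_on S f"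
| "Ck_on (Suc k) S f \<longleftrightarrow> (\<forall>x\<in>S. f differentiable (at x)) \<and>
     (\<forall>v. Ck_on k S (\<lambda>x. frechet_derivative f (at x) v))"

definition smooth_on :: "'e::euclidean_space set \<Rightarrow> ('e \<Rightarrow> 'f::real_normed_vector) \<Rightarrow> bool" where
  "smooth_on S f \<longleftrightarrow> (\<forall>k. Ck_on k S f)"

type_synonym ('a, 'm) chart = "'a set \<times> ('a \<Rightarrow> real ^ 'm)"

abbreviation chart_inv :: "('a, 'm) chart \<Rightarrow> real ^ 'm \<Rightarrow> 'a" where
  "chart_inv c \<equiv> inv_into (fst c) (snd c)"

text \<open>The manifold is the whole type \<open>'a\<close>; its dimension is \<open>CARD('m)\<close>.\<close>

definition smooth_atlas ::
  "('a::{t2_space, second_countable_topology}, 'm::finite) chart set \<Rightarrow> bool" where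
  "smooth_atlas A \<longleftrightarrow>
     (\<Union>c\<in>A. fst c) = UNIV \<and>
     (\<forall>c\<in>A. open (fst c) \<and> open (snd c ` fst c) \<and>
        homeomorphism (fst c) (snd c ` fst c) (snd c) (chart_inv c)) \<and>
     (\<forall>c\<in>A. \<forall>d\<in>A. smooth_on (snd c ` (fst c \<inter> fst d)) (snd d \<circ> chart_inv c))"

definition chart_at :: "('a, 'm) chart set \<Rightarrow> 'a \<Rightarrow> ('a, 'm) chart" where
  "chart_at A p = (SOME c. c \<in> A \<and> p \<in> fst c)"

definition smooth_fun ::
  "('a, 'm::finite) chart set \<Rightarrow> 'a set \<Rightarrow> ('a \<Rightarrow> real) \<Rightarrow> bool" where
  "smooth_fun A U f \<longleftrightarrow> (\<forall>c\<in>A. smooth_on (snd c ` (fst c \<inter> U)) (f \<circ> chart_inv c))"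

text \<open>A tangent vector at \<open>p\<close> is the family of its component vectors in all charts around \<open>p\<close>,
  related by the Jacobians of the coordinate changes (and set to \<open>0\<close> for all other charts).\<close>

type_synonym ('a, 'm) tvec = "('a, 'm) chart \<Rightarrow> real ^ 'm"

definition tangent_space ::
  "('a, 'm::finite) chart set \<Rightarrow> 'a \<Rightarrow> ('a, 'm) tvec set" where
  "tangent_space A p = {v.
     (\<forall>c. \<not> (c \<in> A \<and> p \<in> fst c) \<longrightarrow> v c = 0) \<and>
     (\<forall>c\<in>A. \<forall>d\<in>A. p \<in> fst c \<and> p \<in> fst d \<longrightarrow>
        v d = frechet_derivative (snd d \<circ> chart_inv c) (at (snd c p)) (v c))}"

type_synonym ('a, 'm) vfield = "'a \<Rightarrow> ('a, 'm) tvec"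

text \<open>Smooth vector fields over the open set \<open>U\<close>; their values outside \<open>U\<close> are irrelevant.\<close>

definition vfields :: "('a, 'm::finite) chart set \<Rightarrow> 'a set \<Rightarrow> ('a, 'm) vfield set" where
  "vfields A U = {X. (\<forall>p\<in>U. X p \<in> tangent_space A p) \<and>
     (\<forall>c\<in>A. smooth_on (snd c ` (fst c \<inter> U)) (\<lambda>x. X (chart_inv c x) c))}"

definition dir_deriv ::
  "('a, 'm::finite) chart set \<Rightarrow> 'a \<Rightarrow> ('a, 'm) tvec \<Rightarrow> ('a \<Rightarrow> real) \<Rightarrow> real" where
  "dir_deriv A p v f =
     (let c = chart_at A p in frechet_derivative (f \<circ> chart_inv c) (at (snd c p)) (v c))"

definition lie_bracket ::
  "('a, 'm::finite) chart set \<Rightarrow> ('a, 'm) vfield \<Rightarrow> ('a, 'm) vfield \<Rightarrow> ('a, 'm) vfield" where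
  "lie_bracket A X Y = (\<lambda>p c. if c \<in> A \<and> p \<in> fst c then
       frechet_derivative (\<lambda>x. Y (chart_inv c x) c) (at (snd c p)) (X p c)
     - frechet_derivative (\<lambda>x. X (chart_inv c x) c) (at (snd c p)) (Y p c)
     else 0)"

text \<open>The vector field on the domain of \<open>c\<close> with constant components \<open>u\<close> in the chart \<open>c\<close>.\<close>

definition coord_field ::
  "('a, 'm::finite) chart set \<Rightarrow> ('a, 'm) chart \<Rightarrow> real ^ 'm \<Rightarrow> ('a, 'm) vfield" where
  "coord_field A c u = (\<lambda>q d. if d \<in> A \<and> q \<in> fst d then
       frechet_derivative (snd d \<circ> chart_inv c) (at (snd c q)) u else 0)"

definition local_frame ::
  "('a::topological_space, 'm::finite) chart set \<Rightarrow> 'a set \<Rightarrow> ('m \<Rightarrow> ('a, 'm) vfield) \<Rightarrow> bool" where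
  "local_frame A V E \<longleftrightarrow> open V \<and> (\<forall>\<alpha>. E \<alpha> \<in> vfields A V) \<and>
     (\<forall>p\<in>V. inj (\<lambda>\<alpha>. E \<alpha> p) \<and> independent (range (\<lambda>\<alpha>. E \<alpha> p)) \<and>
        span (range (\<lambda>\<alpha>. E \<alpha> p)) = tangent_space A p)"

section \<open>Covariant tensors\<close>

definition linear_on_subspace :: "'v::real_vector set \<Rightarrow> ('v \<Rightarrow> real) \<Rightarrow> bool" where
  "linear_on_subspace T f \<longleftrightarrow>
     (\<forall>v\<in>T. \<forall>w\<in>T. f (v + w) = f v + f w) \<and> (\<forall>a. \<forall>v\<in>T. f (a *\<^sub>R v) = a * f v)"

type_synonym ('a, 'm) form1 = "'a \<Rightarrow> ('a, 'm) tvec \<Rightarrow> real"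
type_synonym ('a, 'm) tens2 = "'a \<Rightarrow> ('a, 'm) tvec \<Rightarrow> ('a, 'm) tvec \<Rightarrow> real"

text \<open>Only the values on the tangent spaces at points of \<open>U\<close> are relevant.\<close>

definition one_form :: "('a::topological_space, 'm::finite) chart set \<Rightarrow> 'a set \<Rightarrow>
    ('a, 'm) form1 \<Rightarrow> bool" where
  "one_form A U \<omega> \<longleftrightarrow>
     (\<forall>p\<in>U. linear_on_subspace (tangent_space A p) (\<omega> p)) \<and>
     (\<forall>V X. open V \<and> V \<subseteq> U \<and> X \<in> vfields A V \<longrightarrow> smooth_fun A V (\<lambda>p. \<omega> p (X p)))"

definition tensor2 :: "('a::topological_space, 'm::finite) chart set \<Rightarrow> 'a set \<Rightarrow>
    ('a, 'm) tens2 \<Rightarrow> bool" where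
  "tensor2 A U B \<longleftrightarrow>
     (\<forall>p\<in>U. \<forall>v\<in>tangent_space A p.
        linear_on_subspace (tangent_space A p) (\<lambda>w. B p v w) \<and>
        linear_on_subspace (tangent_space A p) (\<lambda>w. B p w v)) \<and>
     (\<forall>V X Y. open V \<and> V \<subseteq> U \<and> X \<in> vfields A V \<and> Y \<in> vfields A V \<longrightarrow>
        smooth_fun A V (\<lambda>p. B p (X p) (Y p)))"

definition symmetric2 :: "('a, 'm::finite) chart set \<Rightarrow> 'a set \<Rightarrow> ('a, 'm) tens2 \<Rightarrow> bool" where
  "symmetric2 A U B \<longleftrightarrow>
     (\<forall>p\<in>U. \<forall>v\<in>tangent_space A p. \<forall>w\<in>tangent_space A p. B p v w = B p w v)"

definition ext_deriv :: "('a, 'm::finite) chart set \<Rightarrow> ('a, 'm) form1 \<Rightarrow>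
    ('a, 'm) vfield \<Rightarrow> ('a, 'm) vfield \<Rightarrow> 'a \<Rightarrow> real" where
  "ext_deriv A \<omega> X Y p = 1 / 2 *
     (dir_deriv A p (X p) (\<lambda>q. \<omega> q (Y q)) - dir_deriv A p (Y p) (\<lambda>q. \<omega> q (X q))
      - \<omega> p (lie_bracket A X Y p))"

definition radical :: "('a, 'm::finite) chart set \<Rightarrow> ('a, 'm) tens2 \<Rightarrow> 'a \<Rightarrow> ('a, 'm) tvec set" where
  "radical A g p = {v \<in> tangent_space A p. \<forall>w\<in>tangent_space A p. g p v w = 0}"

section \<open>Linear connections\<close>

type_synonym ('a, 'm) conn = "('a, 'm) vfield \<Rightarrow> ('a, 'm) vfield \<Rightarrow> ('a, 'm) vfield"

text \<open>A linear connection over \<open>U\<close> acts on vector fields over every open \<open>V \<subseteq> U\<close>, compatibly with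
  restriction; the latter is the last conjunct (applied to a smaller \<open>V\<close>).\<close>

definition connection ::
  "('a::topological_space, 'm::finite) chart set \<Rightarrow> 'a set \<Rightarrow> ('a, 'm) conn \<Rightarrow> bool" where
  "connection A U D \<longleftrightarrow> (\<forall>V. open V \<and> V \<subseteq> U \<longrightarrow>
     (\<forall>X\<in>vfields A V. \<forall>Y\<in>vfields A V. D X Y \<in> vfields A V) \<and>
     (\<forall>X\<in>vfields A V. \<forall>X'\<in>vfields A V. \<forall>Y\<in>vfields A V. \<forall>p\<in>V.
        D (X + X') Y p = D X Y p + D X' Y p) \<and>
     (\<forall>X\<in>vfields A V. \<forall>Y\<in>vfields A V. \<forall>Y'\<in>vfields A V. \<forall>p\<in>V.
        D X (Y + Y') p = D X Y p + D X Y' p) \<and>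
     (\<forall>f. \<forall>X\<in>vfields A V. \<forall>Y\<in>vfields A V. smooth_fun A V f \<longrightarrow> (\<forall>p\<in>V.
        D (\<lambda>q. f q *\<^sub>R X q) Y p = f p *\<^sub>R D X Y p \<and>
        D X (\<lambda>q. f q *\<^sub>R Y q) p = dir_deriv A p (X p) f *\<^sub>R Y p + f p *\<^sub>R D X Y p)) \<and>
     (\<forall>X\<in>vfields A V. \<forall>X'\<in>vfields A V. \<forall>Y\<in>vfields A V. \<forall>Y'\<in>vfields A V.
        (\<forall>p\<in>V. X p = X' p \<and> Y p = Y' p) \<longrightarrow> (\<forall>p\<in>V. D X Y p = D X' Y' p)))"

definition torsion_free ::
  "('a::topological_space, 'm::finite) chart set \<Rightarrow> 'a set \<Rightarrow> ('a, 'm) conn \<Rightarrow> bool" where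
  "torsion_free A U D \<longleftrightarrow> (\<forall>V X Y p. open V \<and> V \<subseteq> U \<and> X \<in> vfields A V \<and> Y \<in> vfields A V \<and> p \<in> V \<longrightarrow>
     D X Y p - D Y X p = lie_bracket A X Y p)"

text \<open>\<open>(D\<^sub>X \<omega>)(Y)\<close> and \<open>(D\<^sub>X B)(Y, Z)\<close> at the point \<open>p\<close>.\<close>

definition cov1 :: "('a, 'm::finite) chart set \<Rightarrow> ('a, 'm) conn \<Rightarrow> ('a, 'm) vfield \<Rightarrow>
    ('a, 'm) form1 \<Rightarrow> ('a, 'm) vfield \<Rightarrow> 'a \<Rightarrow> real" where
  "cov1 A D X \<omega> Y p = dir_deriv A p (X p) (\<lambda>q. \<omega> q (Y q)) - \<omega> p (D X Y p)"

definition cov2 :: "('a, 'm::finite) chart set \<Rightarrow> ('a, 'm) conn \<Rightarrow> ('a, 'm) vfield \<Rightarrow>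
    ('a, 'm) tens2 \<Rightarrow> ('a, 'm) vfield \<Rightarrow> ('a, 'm) vfield \<Rightarrow> 'a \<Rightarrow> real" where
  "cov2 A D X B Y Z p = dir_deriv A p (X p) (\<lambda>q. B q (Y q) (Z q))
     - B p (D X Y p) (Z p) - B p (Y p) (D X Z p)"

definition parallel2 :: "('a::topological_space, 'm::finite) chart set \<Rightarrow> 'a set \<Rightarrow>
    ('a, 'm) conn \<Rightarrow> ('a, 'm) tens2 \<Rightarrow> bool" where
  "parallel2 A U D B \<longleftrightarrow> (\<forall>V X Y Z p. open V \<and> V \<subseteq> U \<and> X \<in> vfields A V \<and> Y \<in> vfields A V \<and>
     Z \<in> vfields A V \<and> p \<in> V \<longrightarrow> cov2 A D X B Y Z p = 0)"

text \<open>The sign of the curvature is opposite to the most common one.\<close>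

definition curvature :: "('a, 'm::finite) chart set \<Rightarrow> ('a, 'm) conn \<Rightarrow>
    ('a, 'm) vfield \<Rightarrow> ('a, 'm) vfield \<Rightarrow> ('a, 'm) vfield \<Rightarrow> ('a, 'm) vfield" where
  "curvature A D X Y Z = D (lie_bracket A X Y) Z - (D X (D Y Z) - D Y (D X Z))"

text \<open>Trace of the endomorphism \<open>Z \<mapsto> R(X, Z)Y\<close> of the tangent space at \<open>p\<close>, identified with
  \<open>real ^ 'm\<close> by a chart; a tangent vector \<open>Z\<close> is extended to a vector field with constant
  components. As the curvature is tensorial, the result depends on neither choice.\<close>

definition ricci :: "('a, 'm::finite) chart set \<Rightarrow> ('a, 'm) conn \<Rightarrow>
    ('a, 'm) vfield \<Rightarrow> ('a, 'm) vfield \<Rightarrow> 'a \<Rightarrow> real" where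
  "ricci A D X Y p = (let c = chart_at A p in
     trace (matrix (\<lambda>u. curvature A D X (coord_field A c u) Y p c)))"

section \<open>Lightlike hypersurfaces of Lorentzian manifolds\<close>

definition lorentzian_metric :: "('b::topological_space, 'k::finite) chart set \<Rightarrow>
    ('b, 'k) tens2 \<Rightarrow> bool" where
  "lorentzian_metric B h \<longleftrightarrow> tensor2 B UNIV h \<and> symmetric2 B UNIV h \<and>
     (\<forall>p. \<exists>(e :: 'k \<Rightarrow> ('b, 'k) tvec) i0. inj e \<and>
        independent (range e) \<and> span (range e) = tangent_space B p \<and>
        (\<forall>i j. h p (e i) (e j) = (if i \<noteq> j then 0 else if i = i0 then - 1 else 1)))"

definition levi_civita :: "('b::topological_space, 'k::finite) chart set \<Rightarrow>
    ('b, 'k) tens2 \<Rightarrow> ('b, 'k) conn \<Rightarrow> bool" where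
  "levi_civita B h D \<longleftrightarrow> connection B UNIV D \<and> torsion_free B UNIV D \<and> parallel2 B UNIV D h"

definition smooth_map :: "('a::topological_space, 'm::finite) chart set \<Rightarrow>
    ('b::topological_space, 'k::finite) chart set \<Rightarrow> ('a \<Rightarrow> 'b) \<Rightarrow> bool" where
  "smooth_map A B \<iota> \<longleftrightarrow> continuous_on UNIV \<iota> \<and>
     (\<forall>c\<in>A. \<forall>d\<in>B. smooth_on (snd c ` (fst c \<inter> \<iota> -` fst d)) (snd d \<circ> \<iota> \<circ> chart_inv c))"

definition differential :: "('a, 'm::finite) chart set \<Rightarrow> ('b, 'k::finite) chart set \<Rightarrow>
    ('a \<Rightarrow> 'b) \<Rightarrow> 'a \<Rightarrow> ('a, 'm) tvec \<Rightarrow> ('b, 'k) tvec" where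
  "differential A B \<iota> p v = (\<lambda>d. if d \<in> B \<and> \<iota> p \<in> fst d then
     (let c = chart_at A p in
        frechet_derivative (snd d \<circ> \<iota> \<circ> chart_inv c) (at (snd c p)) (v c)) else 0)"

definition immersion :: "('a::topological_space, 'm::finite) chart set \<Rightarrow>
    ('b::topological_space, 'k::finite) chart set \<Rightarrow> ('a \<Rightarrow> 'b) \<Rightarrow> bool" where
  "immersion A B \<iota> \<longleftrightarrow> smooth_map A B \<iota> \<and>
     (\<forall>p. inj_on (differential A B \<iota> p) (tangent_space A p))"

text \<open>\<open>g0\<close> is the metric induced by \<open>h\<close>; its rank is \<open>n\<close> iff its radical is a line, as
  \<open>CARD('m) = n + 1\<close>.\<close>

definition lightlike_hypersurface :: "nat \<Rightarrow>
    ('a::{t2_space, second_countable_topology}, 'm::finite) chart set \<Rightarrow>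
    ('b::{t2_space, second_countable_topology}, 'k::finite) chart set \<Rightarrow>
    ('b, 'k) tens2 \<Rightarrow> ('a \<Rightarrow> 'b) \<Rightarrow> ('a, 'm) tens2 \<Rightarrow> bool" where
  "lightlike_hypersurface n A B h \<iota> g0 \<longleftrightarrow>
     CARD('m) = n + 1 \<and> CARD('k) = n + 2 \<and>
     smooth_atlas A \<and> smooth_atlas B \<and> lorentzian_metric B h \<and> immersion A B \<iota> \<and>
     tensor2 A UNIV g0 \<and>
     (\<forall>p. \<forall>v\<in>tangent_space A p. \<forall>w\<in>tangent_space A p.
        g0 p v w = h (\<iota> p) (differential A B \<iota> p v) (differential A B \<iota> p w)) \<and>
     (\<forall>p. dim (radical A g0 p) = 1)"

text \<open>Vector fields \<open>X, Y\<close> tangent to the hypersurface are differentiated by means of local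
  extensions \<open>X', Y'\<close> to the ambient manifold.\<close>

definition totally_geodesic :: "('a::topological_space, 'm::finite) chart set \<Rightarrow>
    ('b::topological_space, 'k::finite) chart set \<Rightarrow>
    ('b, 'k) tens2 \<Rightarrow> ('b, 'k) conn \<Rightarrow> ('a \<Rightarrow> 'b) \<Rightarrow> ('a, 'm) tens2 \<Rightarrow> bool" where
  "totally_geodesic A B h Dbar \<iota> g0 \<longleftrightarrow> (\<forall>U W X Y X' Y' p. \<forall>v\<in>radical A g0 p.
     open U \<and> open W \<and> \<iota> ` U \<subseteq> W \<and> p \<in> U \<and>
     X \<in> vfields A U \<and> Y \<in> vfields A U \<and> X' \<in> vfields B W \<and> Y' \<in> vfields B W \<and>
     (\<forall>q\<in>U. X' (\<iota> q) = differential A B \<iota> q (X q) \<and> Y' (\<iota> q) = differential A B \<iota> q (Y q)) \<longrightarrow>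
     h (\<iota> p) (Dbar X' Y' (\<iota> p)) (differential A B \<iota> p v) = 0)"

section \<open>Screen distributions\<close>

definition smooth_distribution :: "('a::topological_space, 'm::finite) chart set \<Rightarrow> nat \<Rightarrow>
    ('a \<Rightarrow> ('a, 'm) tvec set) \<Rightarrow> bool" where
  "smooth_distribution A k S \<longleftrightarrow> (\<forall>p. \<exists>V F. open V \<and> p \<in> V \<and>
     (\<forall>i<k. F i \<in> vfields A V) \<and>
     (\<forall>q\<in>V. inj_on (\<lambda>i. F i q) {..<k} \<and> independent ((\<lambda>i. F i q) ` {..<k}) \<and>
        span ((\<lambda>i. F i q) ` {..<k}) = S q))"

definition screen_distribution :: "nat \<Rightarrow> ('a::topological_space, 'm::finite) chart set \<Rightarrow>
    ('a, 'm) tens2 \<Rightarrow> ('a \<Rightarrow> ('a, 'm) tvec set) \<Rightarrow> bool" where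
  "screen_distribution n A g0 S \<longleftrightarrow> smooth_distribution A n S \<and>
     (\<forall>p. S p \<subseteq> tangent_space A p \<and> S p \<inter> radical A g0 p = {0} \<and>
        (\<forall>v\<in>tangent_space A p. \<exists>w\<in>S p. \<exists>r\<in>radical A g0 p. v = w + r))"

definition screen_proj :: "('a, 'm::finite) chart set \<Rightarrow> ('a, 'm) tens2 \<Rightarrow>
    ('a \<Rightarrow> ('a, 'm) tvec set) \<Rightarrow> ('a, 'm) vfield \<Rightarrow> ('a, 'm) vfield" where
  "screen_proj A g0 S Y = (\<lambda>p. THE w. w \<in> S p \<and> Y p - w \<in> radical A g0 p)"

text \<open>For a distribution \<open>S\<close> of codimension one: \<open>N\<close> is an embedded hypersurface (locally a regular
  level set) whose tangent spaces are the fibres of \<open>S\<close>. Integral manifolds being needed only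
  locally, they may be taken embedded.\<close>

definition integral_hypersurface :: "('a::topological_space, 'm::finite) chart set \<Rightarrow>
    ('a \<Rightarrow> ('a, 'm) tvec set) \<Rightarrow> 'a set \<Rightarrow> bool" where
  "integral_hypersurface A S N \<longleftrightarrow> (\<forall>p\<in>N. \<exists>V f. open V \<and> p \<in> V \<and> smooth_fun A V f \<and>
     N \<inter> V = {q\<in>V. f q = f p} \<and>
     (\<forall>q\<in>N \<inter> V. (\<exists>v\<in>tangent_space A q. dir_deriv A q v f \<noteq> 0) \<and>
        S q = {v\<in>tangent_space A q. dir_deriv A q v f = 0}))"

definition integrable_distribution :: "('a::topological_space, 'm::finite) chart set \<Rightarrow>
    ('a \<Rightarrow> ('a, 'm) tvec set) \<Rightarrow> bool" where
  "integrable_distribution A S \<longleftrightarrow> (\<forall>p. \<exists>N. p \<in> N \<and> integral_hypersurface A S N)"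

section \<open>Weyl structures\<close>

definition conformal_class :: "('a, 'm::finite) chart set \<Rightarrow> ('a, 'm) tens2 \<Rightarrow>
    ('a, 'm) tens2 set" where
  "conformal_class A g0 = {\<lambda>p v w. exp (- 2 * f p) * g0 p v w | f.
     smooth_fun A UNIV f \<and> (\<forall>p. \<forall>v\<in>radical A g0 p. dir_deriv A p v f = 0)}"

text \<open>\<open>\<theta>\<close> is a one-form with \<open>D g = - 2 \<theta> \<otimes> g\<close>.\<close>

definition weyl_form :: "('a::topological_space, 'm::finite) chart set \<Rightarrow> ('a, 'm) conn \<Rightarrow>
    ('a, 'm) tens2 \<Rightarrow> ('a, 'm) form1 \<Rightarrow> bool" where
  "weyl_form A D g \<theta> \<longleftrightarrow> one_form A UNIV \<theta> \<and>
     (\<forall>V X Y Z p. open V \<and> X \<in> vfields A V \<and> Y \<in> vfields A V \<and> Z \<in> vfields A V \<and> p \<in> V \<longrightarrow>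
        cov2 A D X g Y Z p = - 2 * \<theta> p (X p) * g p (Y p) (Z p))"

definition weyl_structure :: "('a::topological_space, 'm::finite) chart set \<Rightarrow>
    ('a, 'm) tens2 set \<Rightarrow> ('a, 'm) conn \<Rightarrow> bool" where
  "weyl_structure A c D \<longleftrightarrow> connection A UNIV D \<and> torsion_free A UNIV D \<and>
     (\<forall>g\<in>c. \<exists>\<theta>. weyl_form A D g \<theta> \<and>
        (\<forall>\<theta>'. weyl_form A D g \<theta>' \<longrightarrow> (\<forall>p. \<forall>v\<in>tangent_space A p. \<theta>' p v = \<theta> p v)))"

definition weyl_screen_structure :: "('a::topological_space, 'm::finite) chart set \<Rightarrow>
    ('a, 'm) tens2 \<Rightarrow> ('a \<Rightarrow> ('a, 'm) tvec set) \<Rightarrow> ('a, 'm) conn \<Rightarrow> bool" where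
  "weyl_screen_structure A g0 S D \<longleftrightarrow> weyl_structure A (conformal_class A g0) D \<and>
     (\<forall>V X Y p. open V \<and> X \<in> vfields A V \<and> Y \<in> vfields A V \<and> p \<in> V \<longrightarrow>
        D X (screen_proj A g0 S Y) p \<in> S p)"

section \<open>The associated nondegenerate metric\<close>

definition gtilde :: "('a, 'm) tens2 \<Rightarrow> ('a, 'm) form1 \<Rightarrow> ('a, 'm) tens2" where
  "gtilde g \<eta> = (\<lambda>p v w. g p v w + \<eta> p v * \<eta> p w)"

definition sharp :: "('a, 'm::finite) chart set \<Rightarrow> ('a, 'm) tens2 \<Rightarrow> ('a, 'm) form1 \<Rightarrow>
    ('a, 'm) form1 \<Rightarrow> ('a, 'm) vfield" where
  "sharp A g \<eta> \<omega> = (\<lambda>p. THE u. u \<in> tangent_space A p \<and>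
     (\<forall>v\<in>tangent_space A p. gtilde g \<eta> p u v = \<omega> p v))"

text \<open>\<open>inv_metric g \<eta> E p $ \<alpha> $ \<beta>\<close> is the coefficient \<open>g\<^sup>[\<^sup>\<alpha>\<^sup>\<beta>\<^sup>]\<close> with respect to the frame \<open>E\<close>.\<close>

definition inv_metric :: "('a, 'm::finite) tens2 \<Rightarrow> ('a, 'm) form1 \<Rightarrow>
    ('m \<Rightarrow> ('a, 'm) vfield) \<Rightarrow> 'a \<Rightarrow> real ^ 'm ^ 'm" where
  "inv_metric g \<eta> E p = matrix_inv (\<chi> \<alpha> \<beta>. gtilde g \<eta> p (E \<alpha> p) (E \<beta> p))"

definition divergence :: "('a, 'm::finite) tens2 \<Rightarrow> ('a, 'm) form1 \<Rightarrow> ('a, 'm) conn \<Rightarrow>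
    ('m \<Rightarrow> ('a, 'm) vfield) \<Rightarrow> ('a, 'm) vfield \<Rightarrow> 'a \<Rightarrow> real" where
  "divergence g \<eta> Dg E X p =
     (\<Sum>\<alpha>\<in>UNIV. \<Sum>\<beta>\<in>UNIV. inv_metric g \<eta> E p $ \<alpha> $ \<beta> * gtilde g \<eta> p (Dg (E \<alpha>) X p) (E \<beta> p))"

definition screen_normal_section :: "('a::topological_space, 'm::finite) chart set \<Rightarrow> 'a set \<Rightarrow>
    ('a, 'm) tens2 \<Rightarrow> ('a \<Rightarrow> ('a, 'm) tvec set) \<Rightarrow> ('a, 'm) conn \<Rightarrow> ('a, 'm) vfield \<Rightarrow>
    ('a, 'm) form1 \<Rightarrow> bool" where
  "screen_normal_section A U g0 Scr D \<xi> \<eta> \<longleftrightarrow> open U \<and> \<xi> \<in> vfields A U \<and> one_form A U \<eta> \<and>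
     (\<forall>p\<in>U. \<xi> p \<in> radical A g0 p \<and> \<xi> p \<noteq> 0 \<and> D \<xi> \<xi> p = 0 \<and>
        \<eta> p (\<xi> p) = 1 \<and> {v\<in>tangent_space A p. \<eta> p v = 0} = Scr p)"

text \<open>The data attached to the section \<open>\<xi>\<close> over \<open>U\<close>, to a metric \<open>g\<close> of the conformal class and to
  its one-form \<open>\<theta>\<close>: the connection \<open>Dg\<close>, its screen part \<open>Dstar\<close>, the tensors \<open>C\<close>, \<open>S\<close> and the
  form \<open>\<phi>\<close>. The values of \<open>C\<close> matter only if its second argument is in the screen \<open>Scr\<close>.\<close>

definition metric_connection_data :: "('a::topological_space, 'm::finite) chart set \<Rightarrow> 'a set \<Rightarrow>
    ('a, 'm) tens2 \<Rightarrow> ('a \<Rightarrow> ('a, 'm) tvec set) \<Rightarrow> ('a, 'm) conn \<Rightarrow> ('a, 'm) vfield \<Rightarrow>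
    ('a, 'm) form1 \<Rightarrow> ('a, 'm) tens2 \<Rightarrow> ('a, 'm) form1 \<Rightarrow> ('a, 'm) conn \<Rightarrow> ('a, 'm) conn \<Rightarrow>
    ('a, 'm) tens2 \<Rightarrow> ('a, 'm) tens2 \<Rightarrow> ('a, 'm) form1 \<Rightarrow> bool" where
  "metric_connection_data A U g0 Scr D \<xi> \<eta> g \<theta> Dg Dstar C S \<phi> \<longleftrightarrow>
     connection A U Dg \<and> torsion_free A U Dg \<and> parallel2 A U Dg g \<and>
     (\<forall>p\<in>U. Dg \<xi> \<xi> p = 0) \<and>
     tensor2 A U S \<and> symmetric2 A U S \<and> (\<forall>p\<in>U. S p (\<xi> p) (\<xi> p) = 0) \<and>
     (\<forall>p\<in>U. \<forall>v\<in>tangent_space A p. \<forall>w\<in>Scr p. S p v w = C p v w + \<eta> p v * \<theta> p w) \<and>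
     (\<forall>V X Y p. open V \<and> V \<subseteq> U \<and> X \<in> vfields A V \<and> Y \<in> vfields A V \<and> p \<in> V \<longrightarrow>
        D X Y p = Dg X Y p + \<theta> p (X p) *\<^sub>R Y p + \<theta> p (Y p) *\<^sub>R X p
          - g p (X p) (Y p) *\<^sub>R sharp A g \<eta> \<theta> p - S p (X p) (Y p) *\<^sub>R \<xi> p \<and>
        Dg X (screen_proj A g0 Scr Y) p = Dstar X (screen_proj A g0 Scr Y) p
          + C p (X p) (screen_proj A g0 Scr Y p) *\<^sub>R \<xi> p \<and>
        Dstar X (screen_proj A g0 Scr Y) p \<in> Scr p \<and>
        Dg X \<xi> p = \<phi> p (X p) *\<^sub>R \<xi> p)"

end

theory Submission
  imports Defs
begin

text \<open>
  Write \<open>K(X, Y) = D\<^sub>X Y - D\<^sup>g\<^sub>X Y = \<theta>(X) Y + \<theta>(Y) X - g(X, Y) \<theta>\<^sup>\<sharp> - S(X, Y) \<xi>\<close>. As \<open>D\<^sup>g\<close> is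
  torsion-free and \<open>K\<close> is symmetric, with the present sign of the curvature
  \<open>R\<^sup>D(X, Z)Y = R\<^sup>g(X, Z)Y - (D\<^sup>g\<^sub>X K)(Z, Y) + (D\<^sup>g\<^sub>Z K)(X, Y) - K(X, K(Z, Y)) + K(Z, K(X, Y))\<close>.
  In each term on the right, \<open>Z\<close> enters through multiples of \<open>Z\<close> itself, through \<open>D\<^sup>g\<^sub>Z \<theta>\<^sup>\<sharp>\<close>, whose trace
  is the divergence, or through endomorphisms \<open>Z \<mapsto> f(Z) W\<close> with \<open>f\<close> tensorial, whose trace is \<open>f(W)\<close>.
  The formula follows from \<open>g(\<xi>, \<cdot>) = 0\<close>, \<open>S(\<xi>, \<xi>) = 0\<close>, \<open>g(\<theta>\<^sup>\<sharp>, \<cdot>) = \<theta>\<close> and \<open>\<theta>(\<xi>) = 0\<close>; the last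
  identity is the difference formula at \<open>X = Y = \<xi>\<close>, as \<open>D\<^sub>\<xi> \<xi> = D\<^sup>g\<^sub>\<xi> \<xi> = 0\<close>.
\<close>

section \<open>Calculus of smooth maps\<close>

text \<open>The formula is pointwise, but curvatures and covariant derivatives act on vector fields
  over open sets. The computation is therefore carried out on a neighbourhood of \<open>p\<close>
  inside the domain of \<open>chart_at A p\<close>: there coordinate fields exist, every field is a
  combination of them with smooth coefficients, and no cut-off functions are needed. Two points
  resist a formal computation. \<open>\<theta>\<^sup>\<sharp>\<close> is given by a pointwise
  description only, and has to be shown smooth before \<open>D\<^sup>g\<close> may be applied to it.
  And the Ricci tensor is a trace in a chart, whereas the divergence is a sum over an arbitrary
  frame with an inverse matrix; matching them is a change of basis that rests on the nondegeneracy
  of \<open>gtilde\<close>. The constants containing \<open>n\<close> all come from the trace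
  \<open>n + 1\<close> of the identity.\<close>

lemma Ck_on_subset: "Ck_on k S f \<Longrightarrow> T \<subseteq> S \<Longrightarrow> Ck_on k T f"
  by (induction k arbitrary: f) (auto intro: continuous_on_subset)

text \<open>Derivatives at a point of an open set see only the values on that set. So a map may be
  replaced by a formula valid merely on a chart image, where \<open>inv_into\<close> is under
  control.\<close>

lemma Ck_on_cong:
  assumes "open S" "\<And>x. x \<in> S \<Longrightarrow> f x = g x" "Ck_on k S f"
  shows "Ck_on k S g"
  using assms(2,3)
proof (induction k arbitrary: f g)
  case 0
  then show ?case using continuous_on_cong[of S S f g] by simp
next
  case (Suc k)
  have der: "(f has_derivative f') (at x) \<longleftrightarrow> (g has_derivative f') (at x)" if "x \<in> S" for x f'
    using Suc.prems(1) assms(1) that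
    by (metis has_derivative_transform_within_open)
  have fd: "frechet_derivative f (at x) = frechet_derivative g (at x)" if "x \<in> S" for x
    using der[OF that] by (simp add: frechet_derivative_def)
  have "\<forall>x\<in>S. g differentiable (at x)"
    using Suc.prems(2) der by (auto simp: differentiable_def)
  moreover have "Ck_on k S (\<lambda>x. frechet_derivative g (at x) v)" for v
    using Suc.IH[of "\<lambda>x. frechet_derivative f (at x) v" "\<lambda>x. frechet_derivative g (at x) v"]
      Suc.prems(2) fd by simp
  ultimately show ?case by simp
qed

text \<open>Uniqueness of the derivative lets an explicit \<open>f'\<close>, as produced by the
  differentiation rules, stand for \<open>frechet_derivative\<close> in the recursive definition.
  The inductions on the order in the closure properties below use it.\<close>

lemma Ck_on_SucI:
  assumes "open S" "\<And>x. x \<in> S \<Longrightarrow> (f has_derivative f' x) (at x)"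
    and "\<And>v. Ck_on k S (\<lambda>x. f' x v)"
  shows "Ck_on (Suc k) S f"
proof -
  have "frechet_derivative f (at x) = f' x" if "x \<in> S" for x
    using assms(2)[OF that] by (metis frechet_derivative_at)
  then have "Ck_on k S (\<lambda>x. frechet_derivative f (at x) v)" for v
    by (intro Ck_on_cong[OF assms(1) _ assms(3)[of v]]) simp
  then show ?thesis using assms(2) by (auto simp: differentiable_def)
qed

lemma Ck_on_SucD:
  assumes "Ck_on (Suc k) S f"
  shows "x \<in> S \<Longrightarrow> (f has_derivative frechet_derivative f (at x)) (at x)"
    and "Ck_on k S (\<lambda>x. frechet_derivative f (at x) v)"
  using assms by (auto simp: frechet_derivative_works)

lemma Ck_on_Suc_le: "Ck_on (Suc k) S f \<Longrightarrow> Ck_on k S f"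
proof (induction k arbitrary: f)
  case 0
  then show ?case
    by (auto simp: continuous_on_eq_continuous_at
        intro!: differentiable_imp_continuous_on differentiable_at_imp_differentiable_on)
next
  case (Suc k)
  then show ?case by (metis Ck_on.simps(2))
qed

lemma Ck_on_const: "open S \<Longrightarrow> Ck_on k S (\<lambda>x. a)"
  by (induction k arbitrary: a)
    (simp, rule Ck_on_SucI[where f' = "\<lambda>_ _. 0"], simp_all del: Ck_on.simps)

lemma Ck_on_linear:
  assumes "bounded_linear L" "open S" "Ck_on k S f"
  shows "Ck_on k S (\<lambda>x. L (f x))"
  using assms(3)
proof (induction k arbitrary: f)
  case 0
  then show ?case using bounded_linear.continuous_on[OF assms(1)] by simp
next
  case (Suc k)
  show ?case
    by (rule Ck_on_SucI[OF assms(2) bounded_linear.has_derivative[OF assms(1)]])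
      (auto intro!: Ck_on_SucD[OF Suc.prems] Suc.IH simp del: Ck_on.simps)
qed

lemma Ck_on_add:
  assumes "open S" "Ck_on k S f" "Ck_on k S g"
  shows "Ck_on k S (\<lambda>x. f x + g x)"
  using assms(2,3)
proof (induction k arbitrary: f g)
  case 0
  then show ?case by (simp add: continuous_on_add)
next
  case (Suc k)
  show ?case
    by (rule Ck_on_SucI[OF assms(1) has_derivative_add])
      (auto intro!: Ck_on_SucD[OF Suc.prems(1)] Ck_on_SucD[OF Suc.prems(2)] Suc.IH
        simp del: Ck_on.simps)
qed

lemma Ck_on_sum:
  "finite I \<Longrightarrow> open S \<Longrightarrow> (\<And>i. i \<in> I \<Longrightarrow> Ck_on k S (f i)) \<Longrightarrow> Ck_on k S (\<lambda>x. \<Sum>i\<in>I. f i x)"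
  by (induction I rule: finite_induct) (auto intro: Ck_on_const Ck_on_add simp del: Ck_on.simps)

text \<open>The product rule yields two products, each with one factor differentiated and the other
  still of order \<open>Suc k\<close>; \<open>Ck_on_Suc_le\<close> lowers the latter so that the
  induction hypothesis covers both.\<close>

lemma Ck_on_bilinear:
  assumes "bounded_bilinear P" "open S" "Ck_on k S f" "Ck_on k S g"
  shows "Ck_on k S (\<lambda>x. P (f x) (g x))"
  using assms(3,4)
proof (induction k arbitrary: f g)
  case 0
  then show ?case using bounded_bilinear.continuous_on[OF assms(1)] by simp
next
  case (Suc k)
  show ?case
    by (rule Ck_on_SucI[OF assms(2) bounded_bilinear.FDERIV[OF assms(1)]])
      (auto intro!: Ck_on_add assms(2) Ck_on_SucD[OF Suc.prems(1)] Ck_on_SucD[OF Suc.prems(2)]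
        Suc.IH Suc.prems[THEN Ck_on_Suc_le] simp del: Ck_on.simps)
qed

lemmas Ck_on_mult = Ck_on_bilinear[OF bounded_bilinear_mult]
  and Ck_on_scaleR = Ck_on_bilinear[OF bounded_bilinear_scaleR]

lemma Ck_on_compose:
  fixes f :: "'e::euclidean_space \<Rightarrow> 'f::real_normed_vector"
  assumes "open S" "open T" "g ` S \<subseteq> T" "Ck_on k T f" "Ck_on k S g"
  shows "Ck_on k S (\<lambda>x. f (g x))"
  using assms(4,5)
proof (induction k arbitrary: f)
  case 0
  then show ?case using assms(3) by (auto intro: continuous_on_compose2)
next
  case (Suc k)
  let ?f' = "\<lambda>x. frechet_derivative f (at x)" and ?g' = "\<lambda>x. frechet_derivative g (at x)"
  \<comment> \<open>\<open>Ck_on\<close> controls derivatives in fixed directions only, whereas the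
    chain rule evaluates that of \<open>f\<close> in the moving direction \<open>?g' x v\<close>.
    Expanding it in \<open>Basis\<close> leaves fixed directions with scalar coefficients.\<close>
  have "((\<lambda>x. f (g x)) has_derivative (\<lambda>v. \<Sum>b\<in>Basis. (?g' x v \<bullet> b) *\<^sub>R ?f' (g x) b)) (at x)"
    if x: "x \<in> S" for x
  proof -
    have g: "(g has_derivative ?g' x) (at x)" using Ck_on_SucD(1)[OF Suc.prems(2) x] .
    have f: "(f has_derivative ?f' (g x)) (at (g x))"
      using Ck_on_SucD(1)[OF Suc.prems(1)] x assms(3) by blast
    then interpret f': bounded_linear "?f' (g x)" by (rule has_derivative_bounded_linear)
    have "?f' (g x) w = (\<Sum>b\<in>Basis. (w \<bullet> b) *\<^sub>R ?f' (g x) b)" for w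
      by (subst euclidean_representation[of w, symmetric]) (simp only: f'.sum f'.scaleR)
    then have "(\<lambda>v. ?f' (g x) (?g' x v)) = (\<lambda>v. \<Sum>b\<in>Basis. (?g' x v \<bullet> b) *\<^sub>R ?f' (g x) b)"
      by blast
    then show ?thesis using has_derivative_compose[OF g f] by simp
  qed
  moreover have "Ck_on k S (\<lambda>x. \<Sum>b\<in>Basis. (?g' x v \<bullet> b) *\<^sub>R ?f' (g x) b)" for v
    using Ck_on_SucD(2)[OF Suc.prems(2)] Ck_on_SucD(2)[OF Suc.prems(1)] Ck_on_Suc_le[OF Suc.prems(2)]
    by (intro Ck_on_sum Ck_on_scaleR Suc.IH assms(1) finite_Basis
        Ck_on_linear[OF bounded_linear_inner_left]) auto
  ultimately show ?case by (rule Ck_on_SucI[OF assms(1)])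
qed

lemma Ck_on_exp:
  fixes f :: "'e::euclidean_space \<Rightarrow> real"
  assumes "open S" "Ck_on k S f"
  shows "Ck_on k S (\<lambda>x. exp (f x))"
  using assms(2)
proof (induction k)
  case 0
  then show ?case by (simp add: continuous_on_exp)
next
  case (Suc k)
  have "((\<lambda>x. exp (f x)) has_derivative (\<lambda>v. exp (f x) * frechet_derivative f (at x) v)) (at x)"
    if "x \<in> S" for x
    using Ck_on_SucD(1)[OF Suc.prems that] by (auto intro!: derivative_eq_intros simp: mult.commute)
  then show ?case
    by (rule Ck_on_SucI[OF assms(1)])
      (auto intro!: Ck_on_mult assms(1) Suc.IH Ck_on_SucD[OF Suc.prems] Ck_on_Suc_le[OF Suc.prems]
        simp del: Ck_on.simps)
qed

text \<open>The derivative of the reciprocal is again expressed by the reciprocal, so the induction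
  hypothesis applies to its factors.\<close>

lemma Ck_on_inverse:
  fixes f :: "'e::euclidean_space \<Rightarrow> real"
  assumes "open S" "\<And>x. x \<in> S \<Longrightarrow> f x \<noteq> 0" "Ck_on k S f"
  shows "Ck_on k S (\<lambda>x. inverse (f x))"
  using assms(3)
proof (induction k)
  case 0
  then show ?case using assms(2) by (simp add: continuous_on_inverse)
next
  case (Suc k)
  have "((\<lambda>x. inverse (f x)) has_derivative
      (\<lambda>v. - 1 * (inverse (f x) * frechet_derivative f (at x) v * inverse (f x)))) (at x)"
    if "x \<in> S" for x
    using Ck_on_SucD(1)[OF Suc.prems that] assms(2)[OF that]
    by (auto intro!: derivative_eq_intros simp: mult.commute)
  moreover have "Ck_on k S (\<lambda>x. - 1 * (inverse (f x) * frechet_derivative f (at x) v * inverse (f x)))"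
    for v
    by (intro Ck_on_mult Ck_on_const assms(1) Suc.IH Ck_on_SucD(2)[OF Suc.prems]
        Ck_on_Suc_le[OF Suc.prems])
  ultimately show ?case by (rule Ck_on_SucI[OF assms(1)])
qed

section \<open>Closure properties of smooth maps\<close>

lemma smooth_on_subset: "smooth_on S f \<Longrightarrow> T \<subseteq> S \<Longrightarrow> smooth_on T f"
  unfolding smooth_on_def by (blast intro: Ck_on_subset)

lemma smooth_on_cong:
  "smooth_on S f \<Longrightarrow> open S \<Longrightarrow> (\<And>x. x \<in> S \<Longrightarrow> f x = g x) \<Longrightarrow> smooth_on S g"
  unfolding smooth_on_def by (blast intro: Ck_on_cong)

lemma smooth_on_const: "open S \<Longrightarrow> smooth_on S (\<lambda>x. a)"
  unfolding smooth_on_def by (blast intro: Ck_on_const)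

lemma smooth_on_linear:
  "bounded_linear L \<Longrightarrow> open S \<Longrightarrow> smooth_on S f \<Longrightarrow> smooth_on S (\<lambda>x. L (f x))"
  unfolding smooth_on_def by (blast intro: Ck_on_linear)

lemma smooth_on_add:
  "open S \<Longrightarrow> smooth_on S f \<Longrightarrow> smooth_on S g \<Longrightarrow> smooth_on S (\<lambda>x. f x + g x)"
  unfolding smooth_on_def by (blast intro: Ck_on_add)

lemma smooth_on_sum:
  "finite I \<Longrightarrow> open S \<Longrightarrow> (\<And>i. i \<in> I \<Longrightarrow> smooth_on S (f i)) \<Longrightarrow> smooth_on S (\<lambda>x. \<Sum>i\<in>I. f i x)"
  unfolding smooth_on_def by (blast intro: Ck_on_sum)

lemma smooth_on_scaleR:
  "open S \<Longrightarrow> smooth_on S f \<Longrightarrow> smooth_on S g \<Longrightarrow> smooth_on S (\<lambda>x. f x *\<^sub>R g x)"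
  unfolding smooth_on_def by (blast intro: Ck_on_scaleR)

lemma smooth_on_compose:
  "open S \<Longrightarrow> open T \<Longrightarrow> g ` S \<subseteq> T \<Longrightarrow> smooth_on T f \<Longrightarrow> smooth_on S g \<Longrightarrow>
    smooth_on S (\<lambda>x. f (g x))"
  unfolding smooth_on_def by (blast intro: Ck_on_compose)

lemma smooth_on_exp:
  fixes f :: "'e::euclidean_space \<Rightarrow> real"
  shows "open S \<Longrightarrow> smooth_on S f \<Longrightarrow> smooth_on S (\<lambda>x. exp (f x))"
  unfolding smooth_on_def by (blast intro: Ck_on_exp)

lemma smooth_on_inverse:
  fixes f :: "'e::euclidean_space \<Rightarrow> real"
  shows "open S \<Longrightarrow> (\<And>x. x \<in> S \<Longrightarrow> f x \<noteq> 0) \<Longrightarrow> smooth_on S f \<Longrightarrow> smooth_on S (\<lambda>x. inverse (f x))"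
  unfolding smooth_on_def by (blast intro: Ck_on_inverse)

lemma smooth_on_frechet_derivative:
  "smooth_on S f \<Longrightarrow> smooth_on S (\<lambda>x. frechet_derivative f (at x) v)"
  unfolding smooth_on_def by (metis Ck_on_SucD(2))

lemma smooth_on_has_derivative:
  "smooth_on S f \<Longrightarrow> x \<in> S \<Longrightarrow> (f has_derivative frechet_derivative f (at x)) (at x)"
  unfolding smooth_on_def by (metis Ck_on_SucD(1))

lemma smooth_on_continuous_on: "smooth_on S f \<Longrightarrow> continuous_on S f"
  unfolding smooth_on_def by (metis Ck_on.simps(1))

section \<open>Charts, vector fields and tensoriality\<close>

lemma smooth_on_mult:
  fixes f g :: "'e::euclidean_space \<Rightarrow> real"
  shows "open S \<Longrightarrow> smooth_on S f \<Longrightarrow> smooth_on S g \<Longrightarrow> smooth_on S (\<lambda>x. f x * g x)"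
  using smooth_on_scaleR[of S f g] by simp

lemma sum_fun_apply:
  fixes f :: "'i \<Rightarrow> 'x \<Rightarrow> 'y::comm_monoid_add"
  shows "(\<Sum>i\<in>I. f i) x = (\<Sum>i\<in>I. f i x)"
  by (induction I rule: infinite_finite_induct) auto

locale manifold =
  fixes A :: "('a::{t2_space, second_countable_topology}, 'm::finite) chart set"
  assumes atlas: "smooth_atlas A"
begin

section \<open>Chart domains and transition Jacobians\<close>

lemma chart_open: "c \<in> A \<Longrightarrow> open (fst c)"
  using atlas by (simp add: smooth_atlas_def)

lemma chart_homeomorphism:
  "c \<in> A \<Longrightarrow> homeomorphism (fst c) (snd c ` fst c) (snd c) (chart_inv c)"
  using atlas by (simp add: smooth_atlas_def)

lemma chart_inv_left: "c \<in> A \<Longrightarrow> p \<in> fst c \<Longrightarrow> chart_inv c (snd c p) = p"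
  using homeomorphism_apply1[OF chart_homeomorphism] by simp

lemma open_chart_image:
  assumes "c \<in> A" "open U"
  shows "open (snd c ` (fst c \<inter> U))"
proof -
  have "openin (top_of_set (fst c)) (fst c \<inter> U)" using assms(2) by blast
  then have "openin (top_of_set (snd c ` fst c)) (snd c ` (fst c \<inter> U))"
    using homeomorphism_imp_open_map[OF chart_homeomorphism[OF assms(1)]] by blast
  moreover have "open (snd c ` fst c)" using atlas assms(1) by (simp add: smooth_atlas_def)
  ultimately show ?thesis using openin_open_eq by blast
qed

lemma chart_at: "chart_at A p \<in> A" "p \<in> fst (chart_at A p)"
proof -
  have "p \<in> (\<Union>c\<in>A. fst c)" using atlas by (simp add: smooth_atlas_def)
  then have "\<exists>c. c \<in> A \<and> p \<in> fst c" by blast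
  from someI_ex[OF this] show "chart_at A p \<in> A" "p \<in> fst (chart_at A p)"
    by (simp_all add: chart_at_def)
qed

lemma transition_smooth:
  "c \<in> A \<Longrightarrow> d \<in> A \<Longrightarrow> smooth_on (snd c ` (fst c \<inter> fst d)) (snd d \<circ> chart_inv c)"
  using atlas by (simp add: smooth_atlas_def)

lemma transition_has_derivative:
  assumes "c \<in> A" "d \<in> A" "p \<in> fst c" "p \<in> fst d"
  shows "(snd d \<circ> chart_inv c has_derivative
    frechet_derivative (snd d \<circ> chart_inv c) (at (snd c p))) (at (snd c p))"
  using smooth_on_has_derivative[OF transition_smooth] assms by blast

lemma transition_linear:
  assumes "c \<in> A" "d \<in> A" "p \<in> fst c" "p \<in> fst d"
  shows "linear (frechet_derivative (snd d \<circ> chart_inv c) (at (snd c p)))"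
  using transition_has_derivative[OF assms] has_derivative_linear by blast

lemma transition_derivative_self:
  assumes "c \<in> A" "p \<in> fst c"
  shows "frechet_derivative (snd c \<circ> chart_inv c) (at (snd c p)) u = u"
proof -
  have "(snd c \<circ> chart_inv c has_derivative (\<lambda>u. u)) (at (snd c p))"
  proof (rule has_derivative_transform_within_open[where f = "\<lambda>x. x"])
    show "open (snd c ` (fst c \<inter> UNIV))" by (intro open_chart_image open_UNIV assms)
  qed (use assms in \<open>auto simp: chart_inv_left\<close>)
  from frechet_derivative_at[OF this] show ?thesis by (simp add: fun_eq_iff)
qed

text \<open>The cocycle rule for Jacobians: on the open image of the triple overlap, passing through
  \<open>d\<close> is the same as passing directly from \<open>c\<close> to \<open>e\<close>. It is
  what makes the values of \<open>coord_field\<close> tangent vectors.\<close>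

lemma transition_derivative_compose:
  assumes "c \<in> A" "d \<in> A" "e \<in> A" "p \<in> fst c" "p \<in> fst d" "p \<in> fst e"
  shows "frechet_derivative (snd e \<circ> chart_inv d) (at (snd d p))
      (frechet_derivative (snd d \<circ> chart_inv c) (at (snd c p)) u) =
    frechet_derivative (snd e \<circ> chart_inv c) (at (snd c p)) u"
proof -
  let ?j = "\<lambda>c d. frechet_derivative (snd d \<circ> chart_inv c) (at (snd c p))"
  have de: "(snd e \<circ> chart_inv d has_derivative ?j d e) (at ((snd d \<circ> chart_inv c) (snd c p)))"
    using transition_has_derivative[of d e p] assms by (simp add: chart_inv_left)
  have "(snd e \<circ> chart_inv d \<circ> (snd d \<circ> chart_inv c) has_derivative ?j d e \<circ> ?j c d) (at (snd c p))"
    by (rule diff_chain_at[OF transition_has_derivative de]) (use assms in auto)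
  then have "(snd e \<circ> chart_inv c has_derivative ?j d e \<circ> ?j c d) (at (snd c p))"
  proof (rule has_derivative_transform_within_open)
    show "open (snd c ` (fst c \<inter> (fst d \<inter> fst e)))"
      by (intro open_chart_image open_Int chart_open assms)
  qed (use assms in \<open>auto simp: chart_inv_left\<close>)
  from frechet_derivative_at[OF this] show ?thesis by (simp add: fun_eq_iff)
qed

section \<open>Tangent spaces and coordinate fields\<close>

lemma tangent_spaceI:
  assumes "\<And>c. \<not> (c \<in> A \<and> p \<in> fst c) \<Longrightarrow> v c = 0"
    and "\<And>c d. c \<in> A \<Longrightarrow> d \<in> A \<Longrightarrow> p \<in> fst c \<Longrightarrow> p \<in> fst d \<Longrightarrow>
      v d = frechet_derivative (snd d \<circ> chart_inv c) (at (snd c p)) (v c)"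
  shows "v \<in> tangent_space A p"
  unfolding tangent_space_def using assms by blast

lemma tangent_space_transition:
  "v \<in> tangent_space A p \<Longrightarrow> c \<in> A \<Longrightarrow> d \<in> A \<Longrightarrow> p \<in> fst c \<Longrightarrow> p \<in> fst d \<Longrightarrow>
    v d = frechet_derivative (snd d \<circ> chart_inv c) (at (snd c p)) (v c)"
  unfolding tangent_space_def by blast

lemma tangent_space_outside:
  "v \<in> tangent_space A p \<Longrightarrow> \<not> (c \<in> A \<and> p \<in> fst c) \<Longrightarrow> v c = 0"
  unfolding tangent_space_def by blast

lemma subspace_tangent_space: "subspace (tangent_space A p)"
proof (rule subspaceI)
  show "0 \<in> tangent_space A p"
  proof (rule tangent_spaceI)
    fix c d assume "c \<in> A" "d \<in> A" "p \<in> fst c" "p \<in> fst d"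
    from linear_0[OF transition_linear[OF this]]
    show "(0 :: ('a, 'm) tvec) d =
        frechet_derivative (snd d \<circ> chart_inv c) (at (snd c p)) ((0 :: ('a, 'm) tvec) c)"
      by simp
  qed simp
next
  fix v w assume vw: "v \<in> tangent_space A p" "w \<in> tangent_space A p"
  show "v + w \<in> tangent_space A p"
  proof (rule tangent_spaceI)
    fix c d assume cd: "c \<in> A" "d \<in> A" "p \<in> fst c" "p \<in> fst d"
    show "(v + w) d = frechet_derivative (snd d \<circ> chart_inv c) (at (snd c p)) ((v + w) c)"
      using linear_add[OF transition_linear[OF cd]] vw[THEN tangent_space_transition, OF cd] by simp
  qed (simp add: vw[THEN tangent_space_outside])
next
  fix a :: real and v assume v: "v \<in> tangent_space A p"
  show "a *\<^sub>R v \<in> tangent_space A p"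
  proof (rule tangent_spaceI)
    fix c d assume cd: "c \<in> A" "d \<in> A" "p \<in> fst c" "p \<in> fst d"
    show "(a *\<^sub>R v) d = frechet_derivative (snd d \<circ> chart_inv c) (at (snd c p)) ((a *\<^sub>R v) c)"
      using linear_cmul[OF transition_linear[OF cd]] v[THEN tangent_space_transition, OF cd]
      by (simp add: scaleR_fun_def)
  qed (simp add: v[THEN tangent_space_outside] scaleR_fun_def)
qed

lemma coord_field_self: "c \<in> A \<Longrightarrow> p \<in> fst c \<Longrightarrow> coord_field A c u p c = u"
  by (simp add: coord_field_def transition_derivative_self)

lemma coord_field_tangent:
  assumes "c \<in> A" "p \<in> fst c"
  shows "coord_field A c u p \<in> tangent_space A p"
proof (rule tangent_spaceI)
  fix d e assume "d \<in> A" "e \<in> A" "p \<in> fst d" "p \<in> fst e"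
  with transition_derivative_compose[OF assms(1) this(1,2) assms(2) this(3,4)]
  show "coord_field A c u p e =
      frechet_derivative (snd e \<circ> chart_inv d) (at (snd d p)) (coord_field A c u p d)"
    by (simp add: coord_field_def)
qed (auto simp: coord_field_def)

text \<open>One chart around \<open>p\<close> determines the whole family: the entries for other
  charts around \<open>p\<close> follow by the Jacobians, and for the remaining charts both sides
  are 0.\<close>

lemma tangent_eq_coord_field:
  assumes "c \<in> A" "p \<in> fst c" "v \<in> tangent_space A p"
  shows "v = coord_field A c (v c) p"
proof
  fix d
  show "v d = coord_field A c (v c) p d"
    using tangent_space_transition[OF assms(3,1) _ assms(2)] tangent_space_outside[OF assms(3)]
    by (cases "d \<in> A \<and> p \<in> fst d") (auto simp: coord_field_def)
qed

lemma tangent_eqI: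
  assumes "c \<in> A" "p \<in> fst c" "v \<in> tangent_space A p" "w \<in> tangent_space A p" "v c = w c"
  shows "v = w"
  using assms tangent_eq_coord_field by metis

lemma linear_coord_field:
  assumes "c \<in> A" "p \<in> fst c"
  shows "linear (\<lambda>u. coord_field A c u p)"
  using assms transition_linear
  by (intro linearI) (auto simp: coord_field_def scaleR_fun_def fun_eq_iff linear_add linear_cmul)

lemma linear_component_expansion:
  fixes L :: "real ^ 'm \<Rightarrow> 'v::real_vector"
  assumes "linear L"
  shows "L u = (\<Sum>i\<in>UNIV. (u $ i) *\<^sub>R L (axis i 1))"
proof -
  have "u = (\<Sum>i\<in>UNIV. (u $ i) *\<^sub>R axis i 1)"
    using basis_expansion[of u] by (simp add: scalar_mult_eq_scaleR)
  then have "L u = L (\<Sum>i\<in>UNIV. (u $ i) *\<^sub>R axis i 1)" by simp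
  also have "\<dots> = (\<Sum>i\<in>UNIV. (u $ i) *\<^sub>R L (axis i 1))"
    by (simp add: linear_sum[OF assms] linear_cmul[OF assms])
  finally show ?thesis .
qed

lemma tangent_expansion:
  assumes "c \<in> A" "p \<in> fst c" "v \<in> tangent_space A p"
  shows "v = (\<Sum>i\<in>UNIV. (v c $ i) *\<^sub>R coord_field A c (axis i 1) p)"
  using linear_component_expansion[OF linear_coord_field[OF assms(1,2)], of "v c"]
    tangent_eq_coord_field[OF assms] by simp

section \<open>Smooth functions\<close>

lemma smooth_funI:
  "(\<And>c. c \<in> A \<Longrightarrow> smooth_on (snd c ` (fst c \<inter> U)) (\<lambda>x. f (chart_inv c x))) \<Longrightarrow> smooth_fun A U f"
  by (simp add: smooth_fun_def comp_def)

lemma smooth_funD: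
  "smooth_fun A U f \<Longrightarrow> c \<in> A \<Longrightarrow> smooth_on (snd c ` (fst c \<inter> U)) (\<lambda>x. f (chart_inv c x))"
  by (simp add: smooth_fun_def comp_def)

lemma chart_imageE:
  assumes "x \<in> snd c ` (fst c \<inter> U)" "c \<in> A"
  obtains q where "q \<in> fst c" "q \<in> U" "x = snd c q" "chart_inv c x = q"
  using assms chart_inv_left by blast

lemma smooth_fun_subset: "smooth_fun A U f \<Longrightarrow> W \<subseteq> U \<Longrightarrow> smooth_fun A W f"
  unfolding smooth_fun_def by (blast intro: smooth_on_subset)

lemma smooth_fun_const:
  assumes "open U"
  shows "smooth_fun A U (\<lambda>p. a)"
  by (rule smooth_funI) (rule smooth_on_const[OF open_chart_image[OF _ assms]])

lemma smooth_fun_mult: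
  assumes "open U" "smooth_fun A U f" "smooth_fun A U g"
  shows "smooth_fun A U (\<lambda>p. f p * g p)"
proof (rule smooth_funI)
  fix c assume c: "c \<in> A"
  show "smooth_on (snd c ` (fst c \<inter> U)) (\<lambda>x. f (chart_inv c x) * g (chart_inv c x))"
    by (rule smooth_on_mult[OF open_chart_image[OF c assms(1)]
          smooth_funD[OF assms(2) c] smooth_funD[OF assms(3) c]])
qed

lemma smooth_fun_exp:
  assumes "open U" "smooth_fun A U f"
  shows "smooth_fun A U (\<lambda>p. exp (f p))"
proof (rule smooth_funI)
  fix c assume c: "c \<in> A"
  show "smooth_on (snd c ` (fst c \<inter> U)) (\<lambda>x. exp (f (chart_inv c x)))"
    by (rule smooth_on_exp[OF open_chart_image[OF c assms(1)] smooth_funD[OF assms(2) c]])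
qed

lemma smooth_fun_inverse:
  assumes "open U" "\<And>p. p \<in> U \<Longrightarrow> f p \<noteq> 0" "smooth_fun A U f"
  shows "smooth_fun A U (\<lambda>p. inverse (f p))"
proof (rule smooth_funI)
  fix c assume c: "c \<in> A"
  show "smooth_on (snd c ` (fst c \<inter> U)) (\<lambda>x. inverse (f (chart_inv c x)))"
    by (rule smooth_on_inverse[OF open_chart_image[OF c assms(1)] _ smooth_funD[OF assms(3) c]])
      (use assms(2) in \<open>auto elim!: chart_imageE[OF _ c]\<close>)
qed

text \<open>Smoothness is defined in charts, so continuity on the manifold is recovered by composing
  with one chart around \<open>p\<close>; the neighbourhood is the preimage of the nonzero
  reals.\<close>

lemma smooth_fun_nonzero_nhd:
  assumes "open U" "smooth_fun A U f" "p \<in> U" "f p \<noteq> 0"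
  obtains W where "open W" "W \<subseteq> U" "p \<in> W" "\<And>q. q \<in> W \<Longrightarrow> f q \<noteq> 0"
proof -
  let ?c = "chart_at A p"
  have "continuous_on (snd ?c ` (fst ?c \<inter> U)) (f \<circ> chart_inv ?c)"
    using smooth_funD[OF assms(2) chart_at(1)] unfolding comp_def by (rule smooth_on_continuous_on)
  moreover have "continuous_on (fst ?c \<inter> U) (snd ?c)"
    using homeomorphism_cont1[OF chart_homeomorphism[OF chart_at(1)]]
    by (rule continuous_on_subset) simp
  ultimately have "continuous_on (fst ?c \<inter> U) ((f \<circ> chart_inv ?c) \<circ> snd ?c)"
    by (rule continuous_on_compose[rotated])
  then have "continuous_on (fst ?c \<inter> U) f"
    by (rule continuous_on_eq) (simp add: chart_inv_left chart_at)
  moreover have "open (fst ?c \<inter> U)" by (intro open_Int chart_open chart_at assms(1))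
  ultimately have "open (fst ?c \<inter> U \<inter> f -` (- {0}))"
    by (rule continuous_open_preimage) auto
  then show thesis using that[of "fst ?c \<inter> U \<inter> f -` (- {0})"] assms chart_at by auto
qed

section \<open>Smooth vector fields\<close>

lemma vfieldsI:
  assumes "\<And>p. p \<in> U \<Longrightarrow> X p \<in> tangent_space A p"
    and "\<And>c. c \<in> A \<Longrightarrow> smooth_on (snd c ` (fst c \<inter> U)) (\<lambda>x. X (chart_inv c x) c)"
  shows "X \<in> vfields A U"
  using assms by (simp add: vfields_def)

lemma vfields_tangent: "X \<in> vfields A U \<Longrightarrow> p \<in> U \<Longrightarrow> X p \<in> tangent_space A p"
  by (simp add: vfields_def)

lemma vfields_smooth_on:
  "X \<in> vfields A U \<Longrightarrow> c \<in> A \<Longrightarrow> smooth_on (snd c ` (fst c \<inter> U)) (\<lambda>x. X (chart_inv c x) c)"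
  by (simp add: vfields_def)

lemma vfields_subset: "X \<in> vfields A U \<Longrightarrow> W \<subseteq> U \<Longrightarrow> X \<in> vfields A W"
  unfolding vfields_def by (blast intro: smooth_on_subset)

lemma vfields_cong:
  assumes "X \<in> vfields A U" "open U" "\<And>p. p \<in> U \<Longrightarrow> X p = Y p"
  shows "Y \<in> vfields A U"
proof (rule vfieldsI)
  fix c assume c: "c \<in> A"
  show "smooth_on (snd c ` (fst c \<inter> U)) (\<lambda>x. Y (chart_inv c x) c)"
    by (rule smooth_on_cong[OF vfields_smooth_on[OF assms(1) c] open_chart_image[OF c assms(2)]])
      (use assms(3) in \<open>auto elim!: chart_imageE[OF _ c]\<close>)
qed (use vfields_tangent[OF assms(1)] assms(3) in simp)

lemma vfields_zero:
  assumes "open U"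
  shows "0 \<in> vfields A U"
proof (rule vfieldsI)
  fix c assume c: "c \<in> A"
  show "smooth_on (snd c ` (fst c \<inter> U)) (\<lambda>x. (0 :: ('a, 'm) vfield) (chart_inv c x) c)"
    using smooth_on_const[OF open_chart_image[OF c assms]] by simp
qed (simp add: subspace_0[OF subspace_tangent_space])

lemma vfields_add:
  assumes "X \<in> vfields A U" "Y \<in> vfields A U" "open U"
  shows "X + Y \<in> vfields A U"
proof (rule vfieldsI)
  fix c assume c: "c \<in> A"
  show "smooth_on (snd c ` (fst c \<inter> U)) (\<lambda>x. (X + Y) (chart_inv c x) c)"
    using smooth_on_add[OF open_chart_image[OF c assms(3)]
        vfields_smooth_on[OF assms(1) c] vfields_smooth_on[OF assms(2) c]] by simp
qed (simp add: subspace_add[OF subspace_tangent_space] assms(1,2)[THEN vfields_tangent])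

lemma vfields_scaleR:
  assumes "X \<in> vfields A U" "smooth_fun A U f" "open U"
  shows "(\<lambda>p. f p *\<^sub>R X p) \<in> vfields A U"
proof (rule vfieldsI)
  fix c assume c: "c \<in> A"
  show "smooth_on (snd c ` (fst c \<inter> U)) (\<lambda>x. (f (chart_inv c x) *\<^sub>R X (chart_inv c x)) c)"
    using smooth_on_scaleR[OF open_chart_image[OF c assms(3)]
        smooth_funD[OF assms(2) c] vfields_smooth_on[OF assms(1) c]] by (simp add: scaleR_fun_def)
qed (rule subspace_scale[OF subspace_tangent_space vfields_tangent[OF assms(1)]])

lemma vfields_uminus: "X \<in> vfields A U \<Longrightarrow> open U \<Longrightarrow> - X \<in> vfields A U"
  using vfields_scaleR[of X U "\<lambda>_. - 1"] smooth_fun_const[of U "- 1"]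
  by (auto intro: vfields_cong)

lemma vfields_diff:
  assumes "X \<in> vfields A U" "Y \<in> vfields A U" "open U"
  shows "X - Y \<in> vfields A U"
  using vfields_add[OF assms(1) vfields_uminus[OF assms(2,3)] assms(3)] by simp

lemma coord_field_vfields:
  assumes "c \<in> A" "open W" "W \<subseteq> fst c"
  shows "coord_field A c u \<in> vfields A W"
proof (rule vfieldsI)
  show "coord_field A c u p \<in> tangent_space A p" if "p \<in> W" for p
    using coord_field_tangent assms that by blast
next
  fix d assume d: "d \<in> A"
  let ?S = "snd d ` (fst d \<inter> fst c)" and ?T = "snd c ` (fst c \<inter> fst d)"
  have S: "open ?S" by (intro open_chart_image chart_open assms d)
  \<comment> \<open>The Jacobian is a function of the \<open>c\<close>-coordinates, but smoothness
    is required in the \<open>d\<close>-coordinates; hence the composition with the transition from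
    \<open>d\<close> to \<open>c\<close>.\<close>
  have "smooth_on ?S (\<lambda>x. frechet_derivative (snd d \<circ> chart_inv c) (at ((snd c \<circ> chart_inv d) x)) u)"
  proof (rule smooth_on_compose[OF S, where g = "snd c \<circ> chart_inv d"])
    show "open ?T" by (intro open_chart_image chart_open assms d)
    show "(snd c \<circ> chart_inv d) ` ?S \<subseteq> ?T" using d by (auto simp: chart_inv_left)
    show "smooth_on ?T (\<lambda>y. frechet_derivative (snd d \<circ> chart_inv c) (at y) u)"
      by (intro smooth_on_frechet_derivative transition_smooth assms d)
    show "smooth_on ?S (snd c \<circ> chart_inv d)" using transition_smooth[OF d assms(1)] .
  qed
  then have "smooth_on ?S (\<lambda>x. coord_field A c u (chart_inv d x) d)"
  proof (rule smooth_on_cong[OF _ S])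
    fix x assume "x \<in> ?S"
    then obtain q where "q \<in> fst d" "q \<in> fst c" "chart_inv d x = q" by (metis chart_imageE d)
    then show "frechet_derivative (snd d \<circ> chart_inv c) (at ((snd c \<circ> chart_inv d) x)) u =
        coord_field A c u (chart_inv d x) d"
      using d by (simp add: coord_field_def)
  qed
  then show "smooth_on (snd d ` (fst d \<inter> W)) (\<lambda>x. coord_field A c u (chart_inv d x) d)"
    by (rule smooth_on_subset) (use assms in blast)
qed

text \<open>The \<open>c\<close>-components have to be smooth in every chart \<open>d\<close>, while
  \<open>vfields\<close> only provides the \<open>d\<close>-components in \<open>d\<close>. The
  Jacobian from \<open>d\<close> to \<open>c\<close> converts them, with its columns as smooth
  coefficients.\<close>

lemma smooth_fun_component:
  assumes "Z \<in> vfields A W" "open W" "c \<in> A" "W \<subseteq> fst c"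
  shows "smooth_fun A W (\<lambda>q. Z q c $ i)"
  unfolding smooth_fun_def
proof
  fix d assume d: "d \<in> A"
  let ?S = "snd d ` (fst d \<inter> W)"
  have S: "open ?S" by (intro open_chart_image d assms)
  show "smooth_on ?S ((\<lambda>q. Z q c $ i) \<circ> chart_inv d)"
  proof (rule smooth_on_cong[OF _ S])
    show "smooth_on ?S (\<lambda>x. (\<Sum>j\<in>UNIV. (Z (chart_inv d x) d $ j) *\<^sub>R
        frechet_derivative (snd c \<circ> chart_inv d) (at x) (axis j 1)) $ i)"
    proof (intro smooth_on_linear[OF bounded_linear_vec_nth S] smooth_on_sum S smooth_on_scaleR finite)
      show "smooth_on ?S (\<lambda>x. Z (chart_inv d x) d)" using assms d by (simp add: vfields_def)
      show "smooth_on ?S (\<lambda>x. frechet_derivative (snd c \<circ> chart_inv d) (at x) (axis j 1))" for j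
        using smooth_on_frechet_derivative[OF transition_smooth[OF d assms(3)]]
        by (rule smooth_on_subset) (use assms in blast)
    qed
  next
    fix x assume "x \<in> ?S"
    then obtain q where q: "q \<in> fst d" "q \<in> W" "x = snd d q" by blast
    then have qc: "q \<in> fst c" using assms by blast
    have "Z q c = frechet_derivative (snd c \<circ> chart_inv d) (at x) (Z q d)"
      using tangent_space_transition[OF vfields_tangent[OF assms(1) q(2)] d assms(3) q(1) qc] q(3)
      by simp
    then show "(\<Sum>j\<in>UNIV. (Z (chart_inv d x) d $ j) *\<^sub>R
        frechet_derivative (snd c \<circ> chart_inv d) (at x) (axis j 1)) $ i = ((\<lambda>q. Z q c $ i) \<circ> chart_inv d) x"
      using linear_component_expansion[OF transition_linear[OF d assms(3) q(1) qc], of "Z q d"] q d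
      by (simp add: chart_inv_left)
  qed
qed

section \<open>Directional derivatives\<close>

lemma smooth_fun_has_derivative:
  assumes "smooth_fun A W f" "p \<in> W"
  shows "(f \<circ> chart_inv (chart_at A p) has_derivative
    (\<lambda>u. frechet_derivative (f \<circ> chart_inv (chart_at A p)) (at (snd (chart_at A p) p)) u))
    (at (snd (chart_at A p) p))"
  using smooth_on_has_derivative[OF smooth_funD[OF assms(1) chart_at(1)]] assms(2) chart_at(2)
  by (auto simp: comp_def)

lemma dir_deriv_eqI:
  assumes "(f \<circ> chart_inv (chart_at A p) has_derivative f') (at (snd (chart_at A p) p))"
  shows "dir_deriv A p v f = f' (v (chart_at A p))"
  using frechet_derivative_at[OF assms] by (simp add: dir_deriv_def Let_def)

lemma dir_deriv_has_derivative:
  assumes "smooth_fun A W f" "p \<in> W"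
  shows "\<exists>f'. (f \<circ> chart_inv (chart_at A p) has_derivative f') (at (snd (chart_at A p) p)) \<and>
    (\<forall>v. dir_deriv A p v f = f' (v (chart_at A p)))"
  using smooth_fun_has_derivative[OF assms] dir_deriv_eqI by blast

lemma dir_deriv_fun_add:
  assumes "smooth_fun A W f" "smooth_fun A W g" "p \<in> W"
  shows "dir_deriv A p v (\<lambda>q. f q + g q) = dir_deriv A p v f + dir_deriv A p v g"
proof -
  let ?c = "chart_at A p"
  obtain f' where f: "(f \<circ> chart_inv ?c has_derivative f') (at (snd ?c p))"
    "\<And>v. dir_deriv A p v f = f' (v ?c)" using dir_deriv_has_derivative[OF assms(1,3)] by blast
  obtain g' where g: "(g \<circ> chart_inv ?c has_derivative g') (at (snd ?c p))"
    "\<And>v. dir_deriv A p v g = g' (v ?c)" using dir_deriv_has_derivative[OF assms(2,3)] by blast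
  have "((\<lambda>q. f q + g q) \<circ> chart_inv ?c has_derivative (\<lambda>u. f' u + g' u)) (at (snd ?c p))"
    using has_derivative_add[OF f(1) g(1)] by (simp add: comp_def)
  from dir_deriv_eqI[OF this] show ?thesis using f g by simp
qed

lemma dir_deriv_fun_mult:
  assumes "smooth_fun A W f" "smooth_fun A W g" "p \<in> W"
  shows "dir_deriv A p v (\<lambda>q. f q * g q) = dir_deriv A p v f * g p + f p * dir_deriv A p v g"
proof -
  let ?c = "chart_at A p"
  obtain f' where f: "(f \<circ> chart_inv ?c has_derivative f') (at (snd ?c p))"
    "\<And>v. dir_deriv A p v f = f' (v ?c)" using dir_deriv_has_derivative[OF assms(1,3)] by blast
  obtain g' where g: "(g \<circ> chart_inv ?c has_derivative g') (at (snd ?c p))"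
    "\<And>v. dir_deriv A p v g = g' (v ?c)" using dir_deriv_has_derivative[OF assms(2,3)] by blast
  have "((\<lambda>q. f q * g q) \<circ> chart_inv ?c has_derivative (\<lambda>u. f p * g' u + f' u * g p)) (at (snd ?c p))"
    using has_derivative_mult[OF f(1) g(1)] chart_at by (simp add: comp_def chart_inv_left)
  from dir_deriv_eqI[OF this] show ?thesis using f g by simp
qed

lemma dir_deriv_cong:
  assumes "open W" "p \<in> W" "\<And>q. q \<in> W \<Longrightarrow> f q = g q" "smooth_fun A W f"
  shows "dir_deriv A p v f = dir_deriv A p v g"
proof -
  let ?c = "chart_at A p"
  obtain f' where f: "(f \<circ> chart_inv ?c has_derivative f') (at (snd ?c p))"
    "\<And>v. dir_deriv A p v f = f' (v ?c)" using dir_deriv_has_derivative[OF assms(4,2)] by blast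
  have "(g \<circ> chart_inv ?c has_derivative f') (at (snd ?c p))"
    using f(1) open_chart_image[OF chart_at(1) assms(1)]
    by (rule has_derivative_transform_within_open) (use assms chart_at in \<open>auto simp: chart_inv_left\<close>)
  from dir_deriv_eqI[OF this] show ?thesis using f by simp
qed

lemma dir_deriv_vec_add:
  assumes "smooth_fun A W f" "p \<in> W"
  shows "dir_deriv A p (v + w) f = dir_deriv A p v f + dir_deriv A p w f"
  using linear_add[OF has_derivative_linear[OF smooth_fun_has_derivative[OF assms]]]
  by (simp add: dir_deriv_def Let_def)

lemma dir_deriv_vec_scaleR:
  assumes "smooth_fun A W f" "p \<in> W"
  shows "dir_deriv A p (a *\<^sub>R v) f = a * dir_deriv A p v f"
  using linear_cmul[OF has_derivative_linear[OF smooth_fun_has_derivative[OF assms]]]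
  by (simp add: dir_deriv_def scaleR_fun_def Let_def)

text \<open>Linearity over the smooth functions, observed at \<open>p\<close>. The last clause is
  there because fields are functions on the whole type, with arbitrary values outside
  \<open>W\<close>.\<close>

definition tensorial :: "'a set \<Rightarrow> 'a \<Rightarrow> (('a, 'm) vfield \<Rightarrow> 'v::real_vector) \<Rightarrow> bool" where
  "tensorial W p F \<longleftrightarrow>
     (\<forall>Z\<in>vfields A W. \<forall>Z'\<in>vfields A W. F (Z + Z') = F Z + F Z') \<and>
     (\<forall>f. \<forall>Z\<in>vfields A W. smooth_fun A W f \<longrightarrow> F (\<lambda>q. f q *\<^sub>R Z q) = f p *\<^sub>R F Z) \<and>
     (\<forall>Z\<in>vfields A W. \<forall>Z'\<in>vfields A W. (\<forall>q\<in>W. Z q = Z' q) \<longrightarrow> F Z = F Z')"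

lemma vfields_sum:
  assumes "open W" "finite I" "\<And>i. i \<in> I \<Longrightarrow> Z i \<in> vfields A W"
  shows "(\<Sum>i\<in>I. Z i) \<in> vfields A W"
  using assms(2,3)
proof (induction I rule: finite_induct)
  case empty
  show ?case using vfields_zero[OF assms(1)] by (simp only: sum.empty)
next
  case (insert i I)
  then show ?case
    using vfields_add[OF _ _ assms(1), of "Z i" "\<Sum>i\<in>I. Z i"] by (simp only: sum.insert insert_iff simp_thms)
qed

lemma tensorial_add:
  "tensorial W p F \<Longrightarrow> Z \<in> vfields A W \<Longrightarrow> Z' \<in> vfields A W \<Longrightarrow> F (Z + Z') = F Z + F Z'"
  unfolding tensorial_def by blast

lemma tensorial_scaleR:
  "tensorial W p F \<Longrightarrow> Z \<in> vfields A W \<Longrightarrow> smooth_fun A W f \<Longrightarrow>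
    F (\<lambda>q. f q *\<^sub>R Z q) = f p *\<^sub>R F Z"
  unfolding tensorial_def by blast

lemma tensorial_cong:
  "tensorial W p F \<Longrightarrow> Z \<in> vfields A W \<Longrightarrow> Z' \<in> vfields A W \<Longrightarrow>
    (\<And>q. q \<in> W \<Longrightarrow> Z q = Z' q) \<Longrightarrow> F Z = F Z'"
  unfolding tensorial_def by blast

lemma tensorial_sum:
  assumes "tensorial W p F" "open W" "p \<in> W" "finite I" "\<And>i. i \<in> I \<Longrightarrow> Z i \<in> vfields A W"
  shows "F (\<Sum>i\<in>I. Z i) = (\<Sum>i\<in>I. F (Z i))"
  using assms(4,5)
proof (induction I rule: finite_induct)
  case empty
  have "F (0 + 0) = F 0 + F 0"
    by (rule tensorial_add[OF assms(1) vfields_zero[OF assms(2)] vfields_zero[OF assms(2)]])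
  then show ?case by (simp only: sum.empty add_0_right add_cancel_right_right)
next
  case (insert i I)
  have "F (Z i + (\<Sum>i\<in>I. Z i)) = F (Z i) + F (\<Sum>i\<in>I. Z i)"
    by (rule tensorial_add[OF assms(1)]) (use insert assms(2) in \<open>auto intro: vfields_sum\<close>)
  also have "F (\<Sum>i\<in>I. Z i) = (\<Sum>i\<in>I. F (Z i))" using insert by blast
  finally show ?case by (simp only: sum.insert[OF insert(1,2)])
qed

text \<open>Inside a chart domain \<open>Z\<close> is a combination of coordinate fields with smooth
  coefficients, which \<open>F\<close> turns into their values at \<open>p\<close>. In particular
  \<open>F Z\<close> depends only on \<open>Z p\<close>.\<close>

lemma tensorial_expansion:
  assumes F: "tensorial W p F" and W: "open W" "p \<in> W" "c \<in> A" "W \<subseteq> fst c"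
    and Z: "Z \<in> vfields A W"
  shows "F Z = (\<Sum>i\<in>UNIV. (Z p c $ i) *\<^sub>R F (coord_field A c (axis i 1)))"
proof -
  let ?f = "\<lambda>i q. Z q c $ i" and ?d = "\<lambda>i. coord_field A c (axis i 1)"
  have d: "?d i \<in> vfields A W" for i by (rule coord_field_vfields[OF W(3,1,4)])
  have f: "smooth_fun A W (?f i)" for i by (rule smooth_fun_component[OF Z W(1,3,4)])
  have fd: "(\<lambda>q. ?f i q *\<^sub>R ?d i q) \<in> vfields A W" for i by (rule vfields_scaleR[OF d f W(1)])
  \<comment> \<open>The expansion holds at the points of \<open>W\<close> only, not as an equality
    of functions.\<close>
  have "F Z = F (\<Sum>i\<in>UNIV. (\<lambda>q. ?f i q *\<^sub>R ?d i q))"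
  proof (rule tensorial_cong[OF F Z vfields_sum[OF W(1)]])
    fix q assume q: "q \<in> W"
    show "Z q = (\<Sum>i\<in>UNIV. (\<lambda>q. ?f i q *\<^sub>R ?d i q)) q"
      by (subst sum_fun_apply)
        (rule tangent_expansion[OF W(3) subsetD[OF W(4) q] vfields_tangent[OF Z q]])
  qed (use fd in auto)
  also have "\<dots> = (\<Sum>i\<in>UNIV. F (\<lambda>q. ?f i q *\<^sub>R ?d i q))"
    by (rule tensorial_sum[OF F W(1,2)]) (use fd in auto)
  also have "\<dots> = (\<Sum>i\<in>UNIV. (Z p c $ i) *\<^sub>R F (?d i))"
    by (rule sum.cong[OF refl]) (rule tensorial_scaleR[OF F d f])
  finally show ?thesis .
qed

end

section \<open>Connections\<close>

lemma one_form_subset: "one_form A U \<omega> \<Longrightarrow> W \<subseteq> U \<Longrightarrow> one_form A W \<omega>"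
  unfolding one_form_def by (meson subset_iff subset_trans)

lemma tensor2_subset: "tensor2 A U T \<Longrightarrow> W \<subseteq> U \<Longrightarrow> tensor2 A W T"
  unfolding tensor2_def by (meson subset_iff subset_trans)

lemma connection_subset: "connection A U D \<Longrightarrow> W \<subseteq> U \<Longrightarrow> connection A W D"
  unfolding connection_def
  by (rule allI, rule impI, drule spec, drule mp, erule conjE, rule conjI, assumption,
      erule subset_trans, assumption, assumption)

lemma linear_on_subspace_add:
  "linear_on_subspace T f \<Longrightarrow> v \<in> T \<Longrightarrow> w \<in> T \<Longrightarrow> f (v + w) = f v + f w"
  unfolding linear_on_subspace_def by blast

lemma linear_on_subspace_scaleR: "linear_on_subspace T f \<Longrightarrow> v \<in> T \<Longrightarrow> f (a *\<^sub>R v) = a * f v"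
  unfolding linear_on_subspace_def by blast

lemma linear_on_subspace_diff:
  assumes "linear_on_subspace T f" "subspace T" "v \<in> T" "w \<in> T"
  shows "f (v - w) = f v - f w"
  using linear_on_subspace_add[OF assms(1) subspace_diff[OF assms(2-4)] assms(4)]
  by (simp only: diff_add_cancel)

context manifold
begin

lemma one_form_linear: "one_form A U \<omega> \<Longrightarrow> p \<in> U \<Longrightarrow> linear_on_subspace (tangent_space A p) (\<omega> p)"
  unfolding one_form_def by (erule conjE, erule bspec)

lemma one_form_smooth:
  "one_form A U \<omega> \<Longrightarrow> open U \<Longrightarrow> X \<in> vfields A U \<Longrightarrow> smooth_fun A U (\<lambda>p. \<omega> p (X p))"
  unfolding one_form_def by (drule conjunct2, drule spec, drule spec, erule mp) simp

lemma tensor2_linear: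
  assumes "tensor2 A U T" "p \<in> U" "v \<in> tangent_space A p"
  shows "linear_on_subspace (tangent_space A p) (\<lambda>w. T p v w)"
    and "linear_on_subspace (tangent_space A p) (\<lambda>w. T p w v)"
  using assms(1)[unfolded tensor2_def, THEN conjunct1, THEN bspec, OF assms(2),
      THEN bspec, OF assms(3)] by simp_all

lemma tensor2_smooth:
  "tensor2 A U T \<Longrightarrow> open U \<Longrightarrow> X \<in> vfields A U \<Longrightarrow> Y \<in> vfields A U \<Longrightarrow>
    smooth_fun A U (\<lambda>p. T p (X p) (Y p))"
  unfolding tensor2_def
  by (drule conjunct2, drule spec, drule spec, drule spec, erule mp) simp

lemma tensorial_diff:
  assumes "tensorial W p F" "tensorial W p G"
  shows "tensorial W p (\<lambda>Z. F Z - G Z)"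
  unfolding tensorial_def
proof (intro conjI ballI allI impI)
  fix Z Z' assume Z: "Z \<in> vfields A W" "Z' \<in> vfields A W"
  show "F (Z + Z') - G (Z + Z') = F Z - G Z + (F Z' - G Z')"
    by (simp only: assms[THEN tensorial_add, OF Z] add_diff_add)
  show "F Z - G Z = F Z' - G Z'" if "\<forall>q\<in>W. Z q = Z' q"
    using assms[THEN tensorial_cong, OF Z] that by metis
next
  fix f Z assume Z: "Z \<in> vfields A W" "smooth_fun A W f"
  show "F (\<lambda>q. f q *\<^sub>R Z q) - G (\<lambda>q. f q *\<^sub>R Z q) = f p *\<^sub>R (F Z - G Z)"
    by (simp only: assms[THEN tensorial_scaleR, OF Z] scaleR_diff_right)
qed

lemma tensorial_pointwise:
  assumes "p \<in> W" "linear_on_subspace (tangent_space A p) f"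
  shows "tensorial W p (\<lambda>Z. f (Z p))"
  unfolding tensorial_def
proof (intro conjI ballI allI impI)
  fix Z Z' assume "Z \<in> vfields A W" "Z' \<in> vfields A W"
  from this[THEN vfields_tangent, OF assms(1)]
  show "f ((Z + Z') p) = f (Z p) + f (Z' p)"
    using linear_on_subspace_add[OF assms(2)] by simp
next
  fix h Z assume "Z \<in> vfields A W"
  from this[THEN vfields_tangent, OF assms(1)]
  show "f (h p *\<^sub>R Z p) = h p *\<^sub>R f (Z p)"
    using linear_on_subspace_scaleR[OF assms(2)] by simp
qed (use assms in simp)

end

text \<open>Fixing one open set turns the quantification over open subsets in
  \<open>connection\<close> into plain rules; localisation is done afterwards by choosing
  \<open>W\<close> small.\<close>

locale open_connection = manifold A
  for A :: "('a::{t2_space, second_countable_topology}, 'm::finite) chart set" +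
  fixes W :: "'a set" and D :: "('a, 'm) conn"
  assumes open_W: "open W"
    and conn: "connection A W D"
begin

lemmas connD = conn[unfolded connection_def, THEN spec, THEN mp, OF conjI[OF open_W subset_refl]]

lemma conn_vfields: "X \<in> vfields A W \<Longrightarrow> Y \<in> vfields A W \<Longrightarrow> D X Y \<in> vfields A W"
  using connD[THEN conjunct1] by blast

lemma conn_add_left:
  "X \<in> vfields A W \<Longrightarrow> X' \<in> vfields A W \<Longrightarrow> Y \<in> vfields A W \<Longrightarrow> p \<in> W \<Longrightarrow>
    D (X + X') Y p = D X Y p + D X' Y p"
  using connD[THEN conjunct2, THEN conjunct1] by blast

lemma conn_add_right:
  "X \<in> vfields A W \<Longrightarrow> Y \<in> vfields A W \<Longrightarrow> Y' \<in> vfields A W \<Longrightarrow> p \<in> W \<Longrightarrow>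
    D X (Y + Y') p = D X Y p + D X Y' p"
  using connD[THEN conjunct2, THEN conjunct2, THEN conjunct1] by blast

lemma conn_scaleR_left:
  "X \<in> vfields A W \<Longrightarrow> Y \<in> vfields A W \<Longrightarrow> smooth_fun A W f \<Longrightarrow> p \<in> W \<Longrightarrow>
    D (\<lambda>q. f q *\<^sub>R X q) Y p = f p *\<^sub>R D X Y p"
  using connD[THEN conjunct2, THEN conjunct2, THEN conjunct2, THEN conjunct1] by blast

lemma conn_scaleR_right:
  "X \<in> vfields A W \<Longrightarrow> Y \<in> vfields A W \<Longrightarrow> smooth_fun A W f \<Longrightarrow> p \<in> W \<Longrightarrow>
    D X (\<lambda>q. f q *\<^sub>R Y q) p = dir_deriv A p (X p) f *\<^sub>R Y p + f p *\<^sub>R D X Y p"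
  using connD[THEN conjunct2, THEN conjunct2, THEN conjunct2, THEN conjunct1] by blast

lemma conn_cong:
  "X \<in> vfields A W \<Longrightarrow> X' \<in> vfields A W \<Longrightarrow> Y \<in> vfields A W \<Longrightarrow> Y' \<in> vfields A W \<Longrightarrow>
    (\<And>q. q \<in> W \<Longrightarrow> X q = X' q) \<Longrightarrow> (\<And>q. q \<in> W \<Longrightarrow> Y q = Y' q) \<Longrightarrow> p \<in> W \<Longrightarrow>
    D X Y p = D X' Y' p"
  using connD[THEN conjunct2, THEN conjunct2, THEN conjunct2, THEN conjunct2] by blast

lemma conn_diff_right:
  assumes "X \<in> vfields A W" "Y \<in> vfields A W" "Y' \<in> vfields A W" "p \<in> W"
  shows "D X (Y - Y') p = D X Y p - D X Y' p"
  using conn_add_right[OF assms(1) vfields_diff[OF assms(2,3) open_W] assms(3,4)]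
  by (simp only: diff_add_cancel) (simp only: add_diff_cancel)

lemma tensorial_conn:
  assumes "Y \<in> vfields A W" "p \<in> W"
  shows "tensorial W p (\<lambda>Z. D Z Y p)"
  unfolding tensorial_def
proof (intro conjI ballI allI impI)
  show "D Z Y p = D Z' Y p" if "Z \<in> vfields A W" "Z' \<in> vfields A W" "\<forall>q\<in>W. Z q = Z' q" for Z Z'
    using conn_cong[OF that(1,2) assms(1,1) _ _ assms(2)] that(3) by blast
qed (simp_all only: conn_add_left conn_scaleR_left assms)

lemma conn_tangent:
  "X \<in> vfields A W \<Longrightarrow> Y \<in> vfields A W \<Longrightarrow> p \<in> W \<Longrightarrow> D X Y p \<in> tangent_space A p"
  by (rule vfields_tangent[OF conn_vfields])

lemma tensorial_cov1_direction:
  assumes \<omega>: "one_form A W \<omega>" and X: "X \<in> vfields A W" and p: "p \<in> W"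
  shows "tensorial W p (\<lambda>Z. cov1 A D Z \<omega> X p)"
proof -
  note sm = one_form_smooth[OF \<omega> open_W X]
  note lin = one_form_linear[OF \<omega> p]
  note F = tensorial_conn[OF X p]
  show ?thesis
    unfolding tensorial_def cov1_def
  proof (intro conjI ballI allI impI)
    fix Z Z' assume Z: "Z \<in> vfields A W" "Z' \<in> vfields A W"
    show "dir_deriv A p ((Z + Z') p) (\<lambda>q. \<omega> q (X q)) - \<omega> p (D (Z + Z') X p) =
      dir_deriv A p (Z p) (\<lambda>q. \<omega> q (X q)) - \<omega> p (D Z X p)
      + (dir_deriv A p (Z' p) (\<lambda>q. \<omega> q (X q)) - \<omega> p (D Z' X p))"
      using dir_deriv_vec_add[OF sm p] tensorial_add[OF F Z]
        linear_on_subspace_add[OF lin conn_tangent[OF Z(1) X p] conn_tangent[OF Z(2) X p]]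
      by (simp only: plus_fun_apply)
    show "dir_deriv A p (Z p) (\<lambda>q. \<omega> q (X q)) - \<omega> p (D Z X p) =
      dir_deriv A p (Z' p) (\<lambda>q. \<omega> q (X q)) - \<omega> p (D Z' X p)" if "\<forall>q\<in>W. Z q = Z' q"
      using tensorial_cong[OF F Z] that p by metis
  next
    fix f Z assume Z: "Z \<in> vfields A W" and f: "smooth_fun A W f"
    show "dir_deriv A p (f p *\<^sub>R Z p) (\<lambda>q. \<omega> q (X q)) - \<omega> p (D (\<lambda>q. f q *\<^sub>R Z q) X p) =
      f p *\<^sub>R (dir_deriv A p (Z p) (\<lambda>q. \<omega> q (X q)) - \<omega> p (D Z X p))"
      using dir_deriv_vec_scaleR[OF sm p] tensorial_scaleR[OF F Z f]
        linear_on_subspace_scaleR[OF lin conn_tangent[OF Z(1) X p]]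
      by (simp add: algebra_simps)
  qed
qed

text \<open>For \<open>f Z\<close> in place of \<open>Z\<close>, the derivative of
  \<open>\<omega>(f Z)\<close> and the value of \<open>\<omega>\<close> on \<open>D X (f Z)\<close>
  both contain the derivative of \<open>f\<close> times \<open>\<omega>(Z)\<close>, and the two
  cancel.\<close>

lemma tensorial_cov1_argument:
  assumes \<omega>: "one_form A W \<omega>" and X: "X \<in> vfields A W" and p: "p \<in> W"
  shows "tensorial W p (\<lambda>Z. cov1 A D X \<omega> Z p)"
proof -
  note sm = one_form_smooth[OF \<omega> open_W]
  note lin = one_form_linear[OF \<omega>]
  show ?thesis
    unfolding tensorial_def cov1_def
  proof (intro conjI ballI allI impI)
    fix Z Z' assume Z: "Z \<in> vfields A W" "Z' \<in> vfields A W"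
    have "dir_deriv A p (X p) (\<lambda>q. \<omega> q ((Z + Z') q)) =
        dir_deriv A p (X p) (\<lambda>q. \<omega> q (Z q) + \<omega> q (Z' q))"
      by (rule dir_deriv_cong[OF open_W p _ sm[OF vfields_add[OF Z open_W]]])
        (simp only: plus_fun_apply linear_on_subspace_add[OF lin] Z[THEN vfields_tangent])
    then show "dir_deriv A p (X p) (\<lambda>q. \<omega> q ((Z + Z') q)) - \<omega> p (D X (Z + Z') p) =
      dir_deriv A p (X p) (\<lambda>q. \<omega> q (Z q)) - \<omega> p (D X Z p)
      + (dir_deriv A p (X p) (\<lambda>q. \<omega> q (Z' q)) - \<omega> p (D X Z' p))"
      using dir_deriv_fun_add[OF sm[OF Z(1)] sm[OF Z(2)] p] conn_add_right[OF X Z p]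
        linear_on_subspace_add[OF lin[OF p] conn_tangent[OF X Z(1) p] conn_tangent[OF X Z(2) p]]
      by (simp only:)
    show "dir_deriv A p (X p) (\<lambda>q. \<omega> q (Z q)) - \<omega> p (D X Z p) =
      dir_deriv A p (X p) (\<lambda>q. \<omega> q (Z' q)) - \<omega> p (D X Z' p)" if eq: "\<forall>q\<in>W. Z q = Z' q"
    proof -
      have "dir_deriv A p (X p) (\<lambda>q. \<omega> q (Z q)) = dir_deriv A p (X p) (\<lambda>q. \<omega> q (Z' q))"
        by (rule dir_deriv_cong[OF open_W p _ sm[OF Z(1)]]) (use eq in simp)
      moreover have "D X Z p = D X Z' p" using conn_cong[OF X X Z _ _ p] eq by blast
      ultimately show ?thesis by simp
    qed
  next
    fix f Z assume Z: "Z \<in> vfields A W" and f: "smooth_fun A W f"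
    have "dir_deriv A p (X p) (\<lambda>q. \<omega> q (f q *\<^sub>R Z q)) =
        dir_deriv A p (X p) (\<lambda>q. f q * \<omega> q (Z q))"
      by (rule dir_deriv_cong[OF open_W p _ sm[OF vfields_scaleR[OF Z f open_W]]])
        (simp only: linear_on_subspace_scaleR[OF lin] Z[THEN vfields_tangent])
    then show "dir_deriv A p (X p) (\<lambda>q. \<omega> q (f q *\<^sub>R Z q)) - \<omega> p (D X (\<lambda>q. f q *\<^sub>R Z q) p) =
      f p *\<^sub>R (dir_deriv A p (X p) (\<lambda>q. \<omega> q (Z q)) - \<omega> p (D X Z p))"
      using dir_deriv_fun_mult[OF f sm[OF Z] p, of "X p"] conn_scaleR_right[OF X Z f p]
        linear_on_subspace_add[OF lin[OF p]
          subspace_scale[OF subspace_tangent_space vfields_tangent[OF Z p]]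
          subspace_scale[OF subspace_tangent_space conn_tangent[OF X Z p]]]
        linear_on_subspace_scaleR[OF lin[OF p] vfields_tangent[OF Z p]]
        linear_on_subspace_scaleR[OF lin[OF p] conn_tangent[OF X Z p]]
      by (simp only:) (simp add: algebra_simps)
  qed
qed

text \<open>Fixing one argument reduces the case of bilinear forms to that of one-forms.\<close>

lemma one_form_tensor2:
  assumes "tensor2 A W T" "Y \<in> vfields A W"
  shows "one_form A W (\<lambda>q v. T q v (Y q))"
  unfolding one_form_def
proof (intro conjI ballI allI impI)
  show "linear_on_subspace (tangent_space A q) (\<lambda>v. T q v (Y q))" if "q \<in> W" for q
    by (rule tensor2_linear(2)[OF assms(1) that vfields_tangent[OF assms(2) that]])
  fix V X assume V: "open V \<and> V \<subseteq> W \<and> X \<in> vfields A V"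
  then show "smooth_fun A V (\<lambda>q. T q (X q) (Y q))"
    using tensor2_smooth[OF tensor2_subset[OF assms(1)]] vfields_subset[OF assms(2)] by blast
qed

text \<open>The expression is the derivative of the one-form \<open>T(\<cdot>, Y)\<close>, minus
  \<open>T(Z, D X Y)\<close>, which is pointwise in \<open>Z\<close>.\<close>

lemma tensorial_cov2_argument:
  assumes T: "tensor2 A W T" and X: "X \<in> vfields A W" "Y \<in> vfields A W" and p: "p \<in> W"
  shows "tensorial W p (\<lambda>Z. cov2 A D X T Z Y p)"
proof -
  have 1: "tensorial W p (\<lambda>Z. cov1 A D X (\<lambda>q v. T q v (Y q)) Z p)"
    by (rule tensorial_cov1_argument[OF one_form_tensor2[OF T X(2)] X(1) p])
  have 2: "tensorial W p (\<lambda>Z. T p (Z p) (D X Y p))"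
    by (rule tensorial_pointwise[OF p tensor2_linear(2)[OF T p conn_tangent[OF X p]]])
  show ?thesis using tensorial_diff[OF 1 2] by (simp add: cov1_def cov2_def)
qed

lemma tensorial_cov2_direction:
  assumes T: "tensor2 A W T" and X: "X \<in> vfields A W" "Y \<in> vfields A W" and p: "p \<in> W"
  shows "tensorial W p (\<lambda>Z. cov2 A D Z T X Y p)"
proof -
  have 1: "tensorial W p (\<lambda>Z. cov1 A D Z (\<lambda>q v. T q v (Y q)) X p)"
    by (rule tensorial_cov1_direction[OF one_form_tensor2[OF T X(2)] X(1) p])
  note lin = tensor2_linear(1)[OF T p vfields_tangent[OF X(1) p]]
  note F = tensorial_conn[OF X(2) p]
  have 2: "tensorial W p (\<lambda>Z. T p (X p) (D Z Y p))"
    unfolding tensorial_def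
  proof (intro conjI ballI allI impI)
    fix Z Z' assume Z: "Z \<in> vfields A W" "Z' \<in> vfields A W"
    show "T p (X p) (D (Z + Z') Y p) = T p (X p) (D Z Y p) + T p (X p) (D Z' Y p)"
      using linear_on_subspace_add[OF lin conn_tangent[OF Z(1) X(2) p] conn_tangent[OF Z(2) X(2) p]]
        tensorial_add[OF F Z] by (simp only:)
    show "T p (X p) (D Z Y p) = T p (X p) (D Z' Y p)" if "\<forall>q\<in>W. Z q = Z' q"
      using tensorial_cong[OF F Z] that by metis
  next
    fix f Z assume Z: "Z \<in> vfields A W" and f: "smooth_fun A W f"
    show "T p (X p) (D (\<lambda>q. f q *\<^sub>R Z q) Y p) = f p *\<^sub>R T p (X p) (D Z Y p)"
      using linear_on_subspace_scaleR[OF lin conn_tangent[OF Z X(2) p]]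
        tensorial_scaleR[OF F Z f] by simp
  qed
  show ?thesis using tensorial_diff[OF 1 2] by (simp add: cov1_def cov2_def)
qed

end

section \<open>Connections differing by a Weyl tensor\<close>

text \<open>The identities from which the Ricci formula follows, over one open set. As
  \<open>g\<close> is degenerate, \<open>g_sh\<close> does not determine \<open>sh\<close>; it is a
  property to be derived for the field representing \<open>\<theta>\<close> under
  \<open>gtilde\<close>.\<close>

locale weyl_difference = open_connection A W D + G: open_connection A W Dg
  for A :: "('a::{t2_space, second_countable_topology}, 'm::finite) chart set"
    and W and D Dg :: "('a, 'm) conn" +
  fixes \<theta> \<phi> :: "('a, 'm) form1" and g S :: "('a, 'm) tens2" and \<xi> sh :: "('a, 'm) vfield"
  assumes torsion: "\<And>X Y p. X \<in> vfields A W \<Longrightarrow> Y \<in> vfields A W \<Longrightarrow> p \<in> W \<Longrightarrow>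
      Dg X Y p - Dg Y X p = lie_bracket A X Y p"
    and metric: "\<And>X Y Z p. X \<in> vfields A W \<Longrightarrow> Y \<in> vfields A W \<Longrightarrow> Z \<in> vfields A W \<Longrightarrow>
      p \<in> W \<Longrightarrow> cov2 A Dg X g Y Z p = 0"
    and \<theta>: "one_form A W \<theta>" and g: "tensor2 A W g" and S: "tensor2 A W S"
    and g_sym: "symmetric2 A W g" and S_sym: "symmetric2 A W S"
    and \<xi>: "\<xi> \<in> vfields A W" and sh: "sh \<in> vfields A W"
    and \<xi>_nonzero: "\<And>p. p \<in> W \<Longrightarrow> \<xi> p \<noteq> 0"
    and g_\<xi>: "\<And>p v. p \<in> W \<Longrightarrow> v \<in> tangent_space A p \<Longrightarrow> g p (\<xi> p) v = 0"
    and g_sh: "\<And>p v. p \<in> W \<Longrightarrow> v \<in> tangent_space A p \<Longrightarrow> g p (sh p) v = \<theta> p v"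
    and \<theta>_\<xi>: "\<And>p. p \<in> W \<Longrightarrow> \<theta> p (\<xi> p) = 0"
    and S_\<xi>: "\<And>p. p \<in> W \<Longrightarrow> S p (\<xi> p) (\<xi> p) = 0"
    and Dg_\<xi>: "\<And>X p. X \<in> vfields A W \<Longrightarrow> p \<in> W \<Longrightarrow> Dg X \<xi> p = \<phi> p (X p) *\<^sub>R \<xi> p"
    and Dg_\<xi>_\<xi>: "\<And>p. p \<in> W \<Longrightarrow> Dg \<xi> \<xi> p = 0"
    and difference: "\<And>X Y p. X \<in> vfields A W \<Longrightarrow> Y \<in> vfields A W \<Longrightarrow> p \<in> W \<Longrightarrow>
      D X Y p = Dg X Y p + \<theta> p (X p) *\<^sub>R Y p + \<theta> p (Y p) *\<^sub>R X p
        - g p (X p) (Y p) *\<^sub>R sh p - S p (X p) (Y p) *\<^sub>R \<xi> p"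
begin

definition K :: "'a \<Rightarrow> ('a, 'm) tvec \<Rightarrow> ('a, 'm) tvec \<Rightarrow> ('a, 'm) tvec" where
  "K p v w = \<theta> p v *\<^sub>R w + \<theta> p w *\<^sub>R v - g p v w *\<^sub>R sh p - S p v w *\<^sub>R \<xi> p"

definition K_field :: "('a, 'm) vfield \<Rightarrow> ('a, 'm) vfield \<Rightarrow> ('a, 'm) vfield" where
  "K_field X Y = (\<lambda>q. K q (X q) (Y q))"

text \<open>This is \<open>(D\<^sup>g\<^sub>X K)(Z, Y)\<close> written out; no derivative of
  \<open>g\<close> occurs because \<open>g\<close> is parallel.\<close>

definition nabla_K :: "('a, 'm) vfield \<Rightarrow> ('a, 'm) vfield \<Rightarrow> ('a, 'm) vfield \<Rightarrow> ('a, 'm) vfield" where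
  "nabla_K X Z Y p = cov1 A Dg X \<theta> Z p *\<^sub>R Y p + cov1 A Dg X \<theta> Y p *\<^sub>R Z p
     - g p (Z p) (Y p) *\<^sub>R Dg X sh p - cov2 A Dg X S Z Y p *\<^sub>R \<xi> p
     - S p (Z p) (Y p) *\<^sub>R Dg X \<xi> p"

lemmas tangent = vfields_tangent[where U = W]

lemmas \<theta>_add = linear_on_subspace_add[OF one_form_linear[OF \<theta>]]
  and \<theta>_scaleR = linear_on_subspace_scaleR[OF one_form_linear[OF \<theta>]]
  and \<theta>_diff = linear_on_subspace_diff[OF one_form_linear[OF \<theta>] subspace_tangent_space]
  and g_add = linear_on_subspace_add[OF tensor2_linear(1)[OF g]]
    linear_on_subspace_add[OF tensor2_linear(2)[OF g]]
  and g_scaleR = linear_on_subspace_scaleR[OF tensor2_linear(1)[OF g]]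
    linear_on_subspace_scaleR[OF tensor2_linear(2)[OF g]]
  and g_diff = linear_on_subspace_diff[OF tensor2_linear(1)[OF g] subspace_tangent_space]
    linear_on_subspace_diff[OF tensor2_linear(2)[OF g] subspace_tangent_space]
  and S_add = linear_on_subspace_add[OF tensor2_linear(1)[OF S]]
    linear_on_subspace_add[OF tensor2_linear(2)[OF S]]
  and S_scaleR = linear_on_subspace_scaleR[OF tensor2_linear(1)[OF S]]
    linear_on_subspace_scaleR[OF tensor2_linear(2)[OF S]]
  and S_diff = linear_on_subspace_diff[OF tensor2_linear(1)[OF S] subspace_tangent_space]
    linear_on_subspace_diff[OF tensor2_linear(2)[OF S] subspace_tangent_space]

lemma g_commute:
  "p \<in> W \<Longrightarrow> v \<in> tangent_space A p \<Longrightarrow> w \<in> tangent_space A p \<Longrightarrow> g p v w = g p w v"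
  using g_sym unfolding symmetric2_def by simp

lemma S_commute:
  "p \<in> W \<Longrightarrow> v \<in> tangent_space A p \<Longrightarrow> w \<in> tangent_space A p \<Longrightarrow> S p v w = S p w v"
  using S_sym unfolding symmetric2_def by simp

lemma K_tangent:
  assumes "p \<in> W" "v \<in> tangent_space A p" "w \<in> tangent_space A p"
  shows "K p v w \<in> tangent_space A p"
  unfolding K_def
  by (intro subspace_diff subspace_add subspace_scale subspace_tangent_space assms
      tangent[OF \<xi>] tangent[OF sh])

lemma K_commute:
  assumes "p \<in> W" "v \<in> tangent_space A p" "w \<in> tangent_space A p"
  shows "K p v w = K p w v"
  unfolding K_def g_commute[OF assms] S_commute[OF assms] by (simp only: add.commute)

lemma K_add_left:
  assumes "p \<in> W" "v \<in> tangent_space A p" "v' \<in> tangent_space A p" "w \<in> tangent_space A p"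
  shows "K p (v + v') w = K p v w + K p v' w"
  unfolding K_def
  by (simp only: \<theta>_add[OF assms(1-3)] g_add(2)[OF assms(1,4,2,3)] S_add(2)[OF assms(1,4,2,3)])
    (simp add: fun_eq_iff scaleR_fun_def algebra_simps)

lemma K_scaleR_left:
  assumes "p \<in> W" "v \<in> tangent_space A p" "w \<in> tangent_space A p"
  shows "K p (a *\<^sub>R v) w = a *\<^sub>R K p v w"
  unfolding K_def
  by (simp only: \<theta>_scaleR[OF assms(1,2)] g_scaleR(2)[OF assms(1,3,2)] S_scaleR(2)[OF assms(1,3,2)])
    (simp add: fun_eq_iff scaleR_fun_def algebra_simps)

lemma K_diff_left:
  assumes "p \<in> W" "v \<in> tangent_space A p" "v' \<in> tangent_space A p" "w \<in> tangent_space A p"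
  shows "K p (v - v') w = K p v w - K p v' w"
  using K_add_left[OF assms(1) subspace_diff[OF subspace_tangent_space assms(2,3)] assms(3,4)]
  by (simp only: diff_add_cancel) (simp only: add_diff_cancel)

lemma K_add_right:
  assumes "p \<in> W" "v \<in> tangent_space A p" "w \<in> tangent_space A p" "w' \<in> tangent_space A p"
  shows "K p v (w + w') = K p v w + K p v w'"
  using K_add_left[OF assms(1,3,4,2)] K_commute[OF assms(1,2)] assms(3,4)
    subspace_add[OF subspace_tangent_space assms(3,4)]
  by (simp only:)

text \<open>The rules for connections concern sums and multiples of fields, so the pointwise formula
  is first written as a combination of four fields.\<close>

lemma K_field_decomposition:
  "K_field X Y = (\<lambda>q. \<theta> q (X q) *\<^sub>R Y q) + (\<lambda>q. \<theta> q (Y q) *\<^sub>R X q)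
     - (\<lambda>q. g q (X q) (Y q) *\<^sub>R sh q) - (\<lambda>q. S q (X q) (Y q) *\<^sub>R \<xi> q)"
  by (rule ext) (simp add: K_field_def K_def)

lemma K_field_terms:
  assumes "X \<in> vfields A W" "Y \<in> vfields A W"
  shows "(\<lambda>q. \<theta> q (X q) *\<^sub>R Y q) \<in> vfields A W"
    and "(\<lambda>q. g q (X q) (Y q) *\<^sub>R sh q) \<in> vfields A W"
    and "(\<lambda>q. S q (X q) (Y q) *\<^sub>R \<xi> q) \<in> vfields A W"
  by (rule vfields_scaleR[OF assms(2) one_form_smooth[OF \<theta> open_W assms(1)] open_W]
      vfields_scaleR[OF sh tensor2_smooth[OF g open_W assms] open_W]
      vfields_scaleR[OF \<xi> tensor2_smooth[OF S open_W assms] open_W])+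

lemma K_field_vfields:
  assumes "X \<in> vfields A W" "Y \<in> vfields A W"
  shows "K_field X Y \<in> vfields A W"
  unfolding K_field_decomposition
  by (intro vfields_add vfields_diff open_W K_field_terms assms)

lemma difference_K:
  "X \<in> vfields A W \<Longrightarrow> Y \<in> vfields A W \<Longrightarrow> p \<in> W \<Longrightarrow> D X Y p = Dg X Y p + K p (X p) (Y p)"
  unfolding K_def by (simp only: difference) (simp add: fun_eq_iff)

text \<open>The Leibniz rule that identifies \<open>nabla_K\<close> as a covariant derivative:
  derivatives of the coefficient functions are traded for \<open>cov1\<close> and
  \<open>cov2\<close>, and the correction terms assemble into values of \<open>K\<close> with one
  differentiated argument.\<close>

lemma Dg_K_field:
  assumes X: "X \<in> vfields A W" and Z: "Z \<in> vfields A W" and Y: "Y \<in> vfields A W" and p: "p \<in> W"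
  shows "Dg X (K_field Z Y) p =
    K p (Dg X Z p) (Y p) + K p (Z p) (Dg X Y p) + nabla_K X Z Y p"
proof -
  have 1: "Dg X (K_field Z Y) p = Dg X (\<lambda>q. \<theta> q (Z q) *\<^sub>R Y q) p + Dg X (\<lambda>q. \<theta> q (Y q) *\<^sub>R Z q) p
      - Dg X (\<lambda>q. g q (Z q) (Y q) *\<^sub>R sh q) p - Dg X (\<lambda>q. S q (Z q) (Y q) *\<^sub>R \<xi> q) p"
    unfolding K_field_decomposition
    by (simp only: G.conn_diff_right G.conn_add_right vfields_add vfields_diff open_W
        K_field_terms X Y Z p)
  have \<theta>D: "dir_deriv A p (X p) (\<lambda>q. \<theta> q (V q)) = cov1 A Dg X \<theta> V p + \<theta> p (Dg X V p)" for V
    by (simp add: cov1_def)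
  have gD: "dir_deriv A p (X p) (\<lambda>q. g q (Z q) (Y q)) = g p (Dg X Z p) (Y p) + g p (Z p) (Dg X Y p)"
    using metric[OF X Z Y p] by (simp add: cov2_def)
  have SD: "dir_deriv A p (X p) (\<lambda>q. S q (Z q) (Y q)) =
      cov2 A Dg X S Z Y p + S p (Dg X Z p) (Y p) + S p (Z p) (Dg X Y p)"
    by (simp add: cov2_def)
  show ?thesis
    unfolding 1 K_def nabla_K_def
      G.conn_scaleR_right[OF X Y one_form_smooth[OF \<theta> open_W Z] p]
      G.conn_scaleR_right[OF X Z one_form_smooth[OF \<theta> open_W Y] p]
      G.conn_scaleR_right[OF X sh tensor2_smooth[OF g open_W Z Y] p]
      G.conn_scaleR_right[OF X \<xi> tensor2_smooth[OF S open_W Z Y] p] \<theta>D gD SD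
    by (simp add: fun_eq_iff scaleR_fun_def algebra_simps)
qed

lemma D_D:
  assumes X: "X \<in> vfields A W" and Z: "Z \<in> vfields A W" and Y: "Y \<in> vfields A W" and p: "p \<in> W"
  shows "D X (D Z Y) p = Dg X (Dg Z Y) p + K p (Dg X Z p) (Y p) + K p (Z p) (Dg X Y p)
    + nabla_K X Z Y p + K p (X p) (Dg Z Y p) + K p (X p) (K p (Z p) (Y p))"
proof -
  note DgZY = G.conn_vfields[OF Z Y] and kZY = K_field_vfields[OF Z Y]
  have "Dg X (D Z Y) p = Dg X (Dg Z Y + K_field Z Y) p"
    by (rule G.conn_cong[OF X X conn_vfields[OF Z Y] vfields_add[OF DgZY kZY open_W] refl _ p])
      (simp only: plus_fun_apply K_field_def difference_K[OF Z Y])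
  also have "\<dots> = Dg X (Dg Z Y) p
      + (K p (Dg X Z p) (Y p) + K p (Z p) (Dg X Y p) + nabla_K X Z Y p)"
    by (simp only: G.conn_add_right[OF X DgZY kZY p] Dg_K_field[OF X Z Y p])
  finally show ?thesis
    unfolding difference_K[OF X conn_vfields[OF Z Y] p] difference_K[OF Z Y p]
      K_add_right[OF p tangent[OF X p] tangent[OF DgZY p] K_tangent[OF p tangent[OF Z p] tangent[OF Y p]]]
    by (simp only: add.assoc)
qed

text \<open>By vanishing torsion the bracket agrees on \<open>W\<close> with a difference of two
  fields produced by \<open>Dg\<close>, which spares differentiating components in charts.\<close>

lemma lie_bracket_vfields:
  assumes "X \<in> vfields A W" "Y \<in> vfields A W"
  shows "lie_bracket A X Y \<in> vfields A W"
  by (rule vfields_cong[OF vfields_diff[OF G.conn_vfields[OF assms]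
          G.conn_vfields[OF assms(2,1)] open_W] open_W])
    (simp only: minus_apply torsion[OF assms])

text \<open>After substituting \<open>D = Dg + K\<close> twice, the terms
  \<open>K(Z, Dg X Y) + K(X, Dg Z Y)\<close> are symmetric in \<open>X\<close> and \<open>Z\<close>
  and drop out; \<open>K(Dg X Z, Y) - K(Dg Z X, Y)\<close> is absorbed by the bracket term, since
  \<open>Dg\<close> has no torsion.\<close>

lemma curvature_difference:
  assumes X: "X \<in> vfields A W" and Z: "Z \<in> vfields A W" and Y: "Y \<in> vfields A W" and p: "p \<in> W"
  shows "curvature A D X Z Y p = curvature A Dg X Z Y p - nabla_K X Z Y p + nabla_K Z X Y p
    - K p (X p) (K p (Z p) (Y p)) + K p (Z p) (K p (X p) (Y p))"
proof -
  note XT = tangent[OF X p] and YT = tangent[OF Y p] and ZT = tangent[OF Z p]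
  have bracket: "D (lie_bracket A X Z) Y p =
      Dg (lie_bracket A X Z) Y p + K p (Dg X Z p) (Y p) - K p (Dg Z X p) (Y p)"
    unfolding difference_K[OF lie_bracket_vfields[OF X Z] Y p] torsion[OF X Z p, symmetric]
      K_diff_left[OF p G.conn_tangent[OF X Z p] G.conn_tangent[OF Z X p] YT]
    by (simp only: add_diff_eq)
  have curv: "curvature A D' X Z Y p = D' (lie_bracket A X Z) Y p - (D' X (D' Z Y) p - D' Z (D' X Y) p)"
    for D'
    by (simp add: curvature_def)
  show ?thesis
    unfolding curv bracket D_D[OF X Z Y p] D_D[OF Z X Y p]
    by (simp add: fun_eq_iff algebra_simps)
qed

end

section \<open>Traces\<close>

context manifold
begin

text \<open>The argument is a map on fields rather than on tangent vectors, because curvature and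
  connections accept only fields.\<close>

definition chart_trace :: "'a \<Rightarrow> (('a, 'm) vfield \<Rightarrow> ('a, 'm) tvec) \<Rightarrow> real" where
  "chart_trace p F =
     (\<Sum>i\<in>UNIV. F (coord_field A (chart_at A p) (axis i 1)) (chart_at A p) $ i)"

lemma ricci_eq_chart_trace: "ricci A D X Y p = chart_trace p (\<lambda>Z. curvature A D X Z Y p)"
  by (simp add: ricci_def chart_trace_def trace_def matrix_def Let_def)

lemma chart_trace_cong:
  assumes "open W" "W \<subseteq> fst (chart_at A p)" "\<And>Z. Z \<in> vfields A W \<Longrightarrow> F Z = G Z"
  shows "chart_trace p F = chart_trace p G"
  using assms(3)[OF coord_field_vfields[OF chart_at(1) assms(1,2)]] by (simp add: chart_trace_def)

lemma chart_trace_add: "chart_trace p (\<lambda>Z. F Z + G Z) = chart_trace p F + chart_trace p G"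
  by (simp add: chart_trace_def sum.distrib)

lemma chart_trace_diff: "chart_trace p (\<lambda>Z. F Z - G Z) = chart_trace p F - chart_trace p G"
  by (simp add: chart_trace_def sum_subtractf)

lemma chart_trace_const_scaleR: "chart_trace p (\<lambda>Z. a *\<^sub>R F Z) = a * chart_trace p F"
  by (simp add: chart_trace_def scaleR_fun_def sum_distrib_left)

lemma chart_trace_identity: "chart_trace p (\<lambda>Z. Z p) = real CARD('m)"
  by (simp add: chart_trace_def coord_field_self chart_at axis_def)

text \<open>The trace is the sum of \<open>f\<close> on the coordinate fields times the components
  of \<open>Z\<close> at \<open>p\<close>, which \<open>tensorial_expansion\<close> recognises as
  \<open>f Z\<close>.\<close>

lemma chart_trace_rank_one:
  assumes "tensorial W p f" "open W" "p \<in> W" "W \<subseteq> fst (chart_at A p)" "Z \<in> vfields A W"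
  shows "chart_trace p (\<lambda>V. f V *\<^sub>R Z p) = f Z"
  using tensorial_expansion[OF assms(1-3) chart_at(1) assms(4,5)]
  by (simp add: chart_trace_def scaleR_fun_def mult.commute)

lemma linear_on_subspace_expansion:
  assumes "linear_on_subspace (tangent_space A p) f" "c \<in> A" "p \<in> fst c" "v \<in> tangent_space A p"
  shows "f v = (\<Sum>i\<in>UNIV. (v c $ i) * f (coord_field A c (axis i 1) p))"
proof -
  note tangent = coord_field_tangent[OF assms(2,3)] and lin = linear_coord_field[OF assms(2,3)]
  have "linear (\<lambda>u. f (coord_field A c u p))"
    by (rule linearI)
      (simp_all only: linear_add[OF lin] linear_cmul[OF lin] linear_on_subspace_add[OF assms(1)]
        linear_on_subspace_scaleR[OF assms(1)] tangent real_scaleR_def)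
  from linear_component_expansion[OF this, of "v c"] show ?thesis
    using tangent_eq_coord_field[OF assms(2-4)] by simp
qed

text \<open>A change of basis in matrix form: the sum is the trace of a product in which the frame
  matrix \<open>P\<close> and the Gram matrix \<open>Q\<close> cancel, leaving the trace of the
  chart matrix of \<open>F\<close>.\<close>

lemma chart_trace_frame:
  fixes E :: "'m \<Rightarrow> ('a, 'm) vfield"
  assumes F: "tensorial W p F" and FT: "\<And>Z. Z \<in> vfields A W \<Longrightarrow> F Z \<in> tangent_space A p"
    and W: "open W" "p \<in> W" "W \<subseteq> fst (chart_at A p)"
    and E: "\<And>\<alpha>. E \<alpha> \<in> vfields A W" "inj (\<lambda>\<alpha>. E \<alpha> p)" "independent (range (\<lambda>\<alpha>. E \<alpha> p))"
    and H: "\<And>v. v \<in> tangent_space A p \<Longrightarrow> linear_on_subspace (tangent_space A p) (\<lambda>w. H v w)"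
    and H_sym: "\<And>v w. v \<in> tangent_space A p \<Longrightarrow> w \<in> tangent_space A p \<Longrightarrow> H v w = H w v"
    and H_nondegenerate: "\<And>v. v \<in> tangent_space A p \<Longrightarrow> (\<forall>w\<in>tangent_space A p. H v w = 0) \<Longrightarrow> v = 0"
  shows "chart_trace p F = (\<Sum>\<alpha>\<in>UNIV. \<Sum>\<beta>\<in>UNIV.
    matrix_inv (\<chi> \<alpha> \<beta>. H (E \<alpha> p) (E \<beta> p)) $ \<alpha> $ \<beta> * H (F (E \<alpha>)) (E \<beta> p))"
proof -
  define c where "c = chart_at A p"
  define b where "b i = coord_field A c (axis i 1)" for i :: 'm
  have c: "c \<in> A" "p \<in> fst c" by (simp_all add: c_def chart_at)
  have b: "b i \<in> vfields A W" for i
    unfolding b_def by (rule coord_field_vfields[OF c(1) W(1)]) (use W in \<open>simp add: c_def\<close>)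
  have bT: "b i p \<in> tangent_space A p" for i by (rule vfields_tangent[OF b W(2)])
  have ET: "E \<alpha> p \<in> tangent_space A p" for \<alpha> by (rule vfields_tangent[OF E(1) W(2)])
  \<comment> \<open>Row \<alpha> of \<open>P\<close> holds the chart components of
    \<open>E \<alpha>\<close>, row \<open>j\<close> of \<open>L\<close> those of
    \<open>F (b j)\<close>; so \<open>L\<close> is the transpose of the usual matrix, with the same
    trace. \<open>Q\<close> and \<open>G\<close> are the Gram matrices of \<open>H\<close> in the
    two bases.\<close>
  define P where "P = (\<chi> \<alpha> j. E \<alpha> p c $ j)"
  define Q where "Q = (\<chi> i j. H (b i p) (b j p))"
  define L where "L = (\<chi> j i. F (b j) c $ i)"
  define G where "G = (\<chi> \<alpha> \<beta>. H (E \<alpha> p) (E \<beta> p))"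
  have right: "H v w = (\<Sum>j\<in>UNIV. (w c $ j) * H v (b j p))"
    if "v \<in> tangent_space A p" "w \<in> tangent_space A p" for v w
    unfolding b_def by (rule linear_on_subspace_expansion[OF H[OF that(1)] c that(2)])
  have expand: "H v w = (\<Sum>j\<in>UNIV. \<Sum>i\<in>UNIV. (v c $ i) * Q $ i $ j * (w c $ j))"
    if vw: "v \<in> tangent_space A p" "w \<in> tangent_space A p" for v w
  proof -
    have "H v w = (\<Sum>j\<in>UNIV. (w c $ j) * (\<Sum>i\<in>UNIV. (v c $ i) * H (b j p) (b i p)))"
      unfolding right[OF vw] using H_sym[OF vw(1) bT] right[OF bT vw(1)] by simp
    also have "\<dots> = (\<Sum>j\<in>UNIV. \<Sum>i\<in>UNIV. (v c $ i) * Q $ i $ j * (w c $ j))"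
      unfolding Q_def sum_distrib_left by (simp add: H_sym[OF bT bT] ac_simps)
    finally show ?thesis .
  qed
  have frame: "F (E \<alpha>) c $ i = (P ** L) $ \<alpha> $ i" for \<alpha> i
  proof -
    have "F (E \<alpha>) = (\<Sum>j\<in>UNIV. (E \<alpha> p c $ j) *\<^sub>R F (b j))"
      unfolding b_def using tensorial_expansion[OF F W(1,2) c(1) _ E(1)] W(3) by (simp add: c_def)
    then show ?thesis
      by (simp add: P_def L_def matrix_matrix_mult_def scaleR_fun_def sum_fun_apply)
  qed
  have triple: "(M ** Q ** transpose P) $ \<alpha> $ \<beta> =
      (\<Sum>j\<in>UNIV. \<Sum>i\<in>UNIV. M $ \<alpha> $ i * Q $ i $ j * (E \<beta> p c $ j))" for M :: "real ^ 'm ^ 'm" and \<alpha> \<beta>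
    by (simp add: matrix_matrix_mult_def transpose_def P_def sum_distrib_right)
  have "G $ \<alpha> $ \<beta> = (P ** Q ** transpose P) $ \<alpha> $ \<beta>" for \<alpha> \<beta>
    unfolding triple by (simp add: G_def P_def expand[OF ET ET])
  then have G: "G = P ** Q ** transpose P" by (simp only: vec_eq_iff) simp
  have FE: "H (F (E \<alpha>)) (E \<beta> p) = (P ** L ** Q ** transpose P) $ \<alpha> $ \<beta>" for \<alpha> \<beta>
    unfolding expand[OF FT[OF E(1)] ET] frame triple ..
  have "invertible P"
    unfolding invertible_right_inverse matrix_right_invertible_independent_rows
  proof (intro allI impI)
    fix x :: "'m \<Rightarrow> real" and \<alpha>
    assume 0: "(\<Sum>i\<in>UNIV. x i *s row i P) = 0"
    let ?v = "\<Sum>\<alpha>\<in>UNIV. x \<alpha> *\<^sub>R E \<alpha> p"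
    have "?v c = (\<Sum>i\<in>UNIV. x i *s row i P)"
      by (simp add: sum_fun_apply vec_eq_iff row_def P_def scaleR_fun_def)
    then have "?v = 0"
      using 0 by (intro tangent_eqI[OF c] subspace_sum subspace_scale subspace_tangent_space ET
          subspace_0[OF subspace_tangent_space]) simp
    \<comment> \<open>\<open>independentD\<close> takes coefficients indexed by the vectors
      themselves, so the sum is reindexed through the inverse of the injective frame.\<close>
    moreover have "?v = (\<Sum>v\<in>range (\<lambda>\<alpha>. E \<alpha> p). x (inv (\<lambda>\<alpha>. E \<alpha> p) v) *\<^sub>R v)"
      by (simp only: sum.reindex[OF E(2)] comp_def inv_f_f[OF E(2)])
    ultimately have "(\<Sum>v\<in>range (\<lambda>\<alpha>. E \<alpha> p). x (inv (\<lambda>\<alpha>. E \<alpha> p) v) *\<^sub>R v) = 0"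
      by (simp only:)
    then have "x (inv (\<lambda>\<alpha>. E \<alpha> p) (E \<alpha> p)) = 0"
      by (rule independentD[OF E(3) _ subset_refl, rotated]) simp_all
    then show "x \<alpha> = 0" by (simp only: inv_f_f[OF E(2)])
  qed
  then obtain P' where P': "P' ** P = mat 1" unfolding invertible_def by blast
  \<comment> \<open>A kernel vector of the Gram matrix consists of the components of a tangent
    vector orthogonal to all others, which is 0 by nondegeneracy.\<close>
  have "invertible Q"
    unfolding invertible_left_inverse matrix_left_invertible_ker
  proof (intro allI impI)
    fix x assume x: "Q *v x = 0"
    let ?v = "coord_field A c x p"
    have v: "?v \<in> tangent_space A p" "?v c = x"
      using coord_field_tangent[OF c] coord_field_self[OF c] by blast+
    have "H w ?v = 0" if w: "w \<in> tangent_space A p" for w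
    proof -
      have "H w ?v = (\<Sum>i\<in>UNIV. (w c $ i) * (Q *v x) $ i)"
        unfolding expand[OF w v(1)] v(2)
        by (subst sum.swap) (simp add: matrix_vector_mult_def sum_distrib_left mult.assoc)
      then show ?thesis using x by simp
    qed
    then have "?v = 0" using H_nondegenerate[OF v(1)] H_sym[OF v(1)] by simp
    then show "x = 0" using v(2) by simp
  qed
  then have "invertible G"
    unfolding G using \<open>invertible P\<close> by (intro invertible_mult transpose_invertible) simp_all
  have G': "G ** matrix_inv G = mat 1"  "matrix_inv G ** G = mat 1"
    using someI_ex[OF \<open>invertible G\<close>[unfolded invertible_def]] by (simp_all add: matrix_inv_def)
  \<comment> \<open>Contracting over equal index positions produces the transpose of
    \<open>matrix_inv G\<close>; by symmetry of \<open>G\<close> this is a right inverse as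
    well.\<close>
  have "transpose G = G"
    by (simp add: G_def vec_eq_iff transpose_def H_sym[OF ET ET])
  then have GT: "G ** transpose (matrix_inv G) = mat 1"
    using G'(2) by (metis matrix_transpose_mul transpose_mat)
  \<comment> \<open>Inserting \<open>G = P ** Q ** transpose P\<close> into \<open>GT\<close> and
    multiplying by \<open>P\<close> on the right; the left inverse \<open>P'\<close> then removes
    the outer \<open>P\<close>.\<close>
  have "P ** (Q ** transpose P ** transpose (matrix_inv G) ** P) = P"
    using GT by (simp add: G matrix_mul_assoc)
  then have N: "Q ** transpose P ** transpose (matrix_inv G) ** P = mat 1"
    using P' by (metis matrix_mul_assoc matrix_mul_lid)
  have contraction: "trace (M ** transpose N) = (\<Sum>\<alpha>\<in>UNIV. \<Sum>\<beta>\<in>UNIV. N $ \<alpha> $ \<beta> * M $ \<alpha> $ \<beta>)"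
    for M N :: "real ^ 'm ^ 'm"
    by (simp add: trace_def matrix_matrix_mult_def transpose_def mult.commute)
  have "(\<Sum>\<alpha>\<in>UNIV. \<Sum>\<beta>\<in>UNIV. matrix_inv G $ \<alpha> $ \<beta> * H (F (E \<alpha>)) (E \<beta> p)) =
      trace ((P ** L ** Q ** transpose P) ** transpose (matrix_inv G))"
    unfolding FE contraction ..
  also have "\<dots> = trace (P ** (L ** (Q ** transpose P ** transpose (matrix_inv G))))"
    by (simp only: matrix_mul_assoc)
  also have "\<dots> = trace (L ** (Q ** transpose P ** transpose (matrix_inv G) ** P))"
    by (subst trace_mul_sym) (simp only: matrix_mul_assoc)
  also have "\<dots> = chart_trace p F"
    unfolding N by (simp add: chart_trace_def trace_def L_def b_def c_def)
  finally show ?thesis unfolding G_def by simp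
qed

end

context weyl_difference
begin

lemma tensorial_\<theta>: "p \<in> W \<Longrightarrow> tensorial W p (\<lambda>Z. \<theta> p (Z p))"
  by (rule tensorial_pointwise[OF _ one_form_linear[OF \<theta>]])

lemma tensorial_g:
  "p \<in> W \<Longrightarrow> v \<in> tangent_space A p \<Longrightarrow> tensorial W p (\<lambda>Z. g p (Z p) v)"
  by (rule tensorial_pointwise[OF _ tensor2_linear(2)[OF g]])

lemma tensorial_S:
  "p \<in> W \<Longrightarrow> v \<in> tangent_space A p \<Longrightarrow> tensorial W p (\<lambda>Z. S p (Z p) v)"
  by (rule tensorial_pointwise[OF _ tensor2_linear(2)[OF S]])

text \<open>\<open>\<phi>\<close> is known only through \<open>Dg_\<xi>\<close>: the tensoriality of
  \<open>Dg Z \<xi>\<close> in \<open>Z\<close> passes to the coefficient because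
  \<open>\<xi>\<close> does not vanish.\<close>

lemma tensorial_\<phi>:
  assumes p: "p \<in> W"
  shows "tensorial W p (\<lambda>Z. \<phi> p (Z p))"
proof -
  note F = G.tensorial_conn[OF \<xi> p]
  have cancel: "a = b" if "a *\<^sub>R \<xi> p = b *\<^sub>R \<xi> p" for a b
    using that \<xi>_nonzero[OF p] by (simp only: scaleR_cancel_right) simp
  show ?thesis
    unfolding tensorial_def
  proof (intro conjI ballI allI impI)
    fix Z Z' assume Z: "Z \<in> vfields A W" "Z' \<in> vfields A W"
    show "\<phi> p ((Z + Z') p) = \<phi> p (Z p) + \<phi> p (Z' p)"
      by (rule cancel) (simp only: scaleR_add_left Dg_\<xi>[OF _ p, symmetric] tensorial_add[OF F Z]
          Z vfields_add[OF Z open_W])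
    show "\<phi> p (Z p) = \<phi> p (Z' p)" if "\<forall>q\<in>W. Z q = Z' q" using that p by simp
  next
    fix f Z assume Z: "Z \<in> vfields A W" and f: "smooth_fun A W f"
    have "\<phi> p (f p *\<^sub>R Z p) *\<^sub>R \<xi> p = Dg (\<lambda>q. f q *\<^sub>R Z q) \<xi> p"
      by (rule Dg_\<xi>[OF vfields_scaleR[OF Z f open_W] p, symmetric])
    also have "\<dots> = (f p *\<^sub>R \<phi> p (Z p)) *\<^sub>R \<xi> p"
      by (simp only: tensorial_scaleR[OF F Z f] Dg_\<xi>[OF Z p] scaleR_scaleR real_scaleR_def)
    finally show "\<phi> p (f p *\<^sub>R Z p) = f p *\<^sub>R \<phi> p (Z p)" by (rule cancel)
  qed
qed

end

section \<open>Evaluations and contractions of the difference tensor\<close>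

context weyl_difference
begin

lemma linear_K:
  assumes f: "linear_on_subspace (tangent_space A p) f"
    and p: "p \<in> W" "v \<in> tangent_space A p" "w \<in> tangent_space A p"
  shows "f (K p v w) = \<theta> p v * f w + \<theta> p w * f v - g p v w * f (sh p) - S p v w * f (\<xi> p)"
proof -
  note sub = subspace_tangent_space[of p]
  note T = tangent[OF sh p(1)] tangent[OF \<xi> p(1)] p(2,3)
  note sc = T[THEN subspace_scale[OF sub]]
  show ?thesis
    unfolding K_def
    by (simp only: linear_on_subspace_diff[OF f sub] linear_on_subspace_add[OF f]
        linear_on_subspace_scaleR[OF f] subspace_diff[OF sub] subspace_add[OF sub] sc T)
qed

lemma linear_on_subspace_K:
  assumes f: "linear_on_subspace (tangent_space A p) f" and p: "p \<in> W" "w \<in> tangent_space A p"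
  shows "linear_on_subspace (tangent_space A p) (\<lambda>v. f (K p v w))"
  unfolding linear_on_subspace_def
  by (intro conjI ballI allI)
    (simp_all only: K_add_left[OF p(1) _ _ p(2)] K_scaleR_left[OF p(1) _ p(2)]
      linear_on_subspace_add[OF f] linear_on_subspace_scaleR[OF f] K_tangent[OF p(1) _ p(2)])

lemma \<theta>_K:
  assumes p: "p \<in> W" and v: "v \<in> tangent_space A p" and w: "w \<in> tangent_space A p"
  shows "\<theta> p (K p v w) = 2 * \<theta> p v * \<theta> p w - g p v w * g p (sh p) (sh p)"
  unfolding linear_K[OF one_form_linear[OF \<theta> p] p v w] \<theta>_\<xi>[OF p]
  using g_sh[OF p tangent[OF sh p]] by simp

lemma g_K:
  assumes p: "p \<in> W" and v: "v \<in> tangent_space A p" and w: "w \<in> tangent_space A p"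
    and u: "u \<in> tangent_space A p"
  shows "g p u (K p v w) = \<theta> p v * g p u w + \<theta> p w * g p u v - g p v w * g p u (sh p)"
  unfolding linear_K[OF tensor2_linear(1)[OF g p u] p v w]
  using g_commute[OF p u tangent[OF \<xi> p]] g_\<xi>[OF p u] by simp

lemma S_K:
  assumes p: "p \<in> W" and v: "v \<in> tangent_space A p" and w: "w \<in> tangent_space A p"
    and u: "u \<in> tangent_space A p"
  shows "S p u (K p v w) = \<theta> p v * S p u w + \<theta> p w * S p u v - g p v w * S p u (sh p)
    - S p v w * S p u (\<xi> p)"
  by (rule linear_K[OF tensor2_linear(1)[OF S p u] p v w])

lemma g_sh_right: "p \<in> W \<Longrightarrow> v \<in> tangent_space A p \<Longrightarrow> g p v (sh p) = \<theta> p v"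
  using g_commute[OF _ _ tangent[OF sh]] g_sh by simp

text \<open>Since \<open>g\<close> is parallel and \<open>sh\<close> represents \<open>\<theta>\<close>, the derivatives of \<open>sh\<close> represent those
  of \<open>\<theta>\<close>.\<close>

lemma g_Dg_sh:
  assumes X: "X \<in> vfields A W" and Y: "Y \<in> vfields A W" and p: "p \<in> W"
  shows "g p (Dg X sh p) (Y p) = cov1 A Dg X \<theta> Y p"
proof -
  have "dir_deriv A p (X p) (\<lambda>q. g q (sh q) (Y q)) = dir_deriv A p (X p) (\<lambda>q. \<theta> q (Y q))"
    by (rule dir_deriv_cong[OF open_W p _ tensor2_smooth[OF g open_W sh Y]])
      (rule g_sh[OF _ tangent[OF Y]])
  then show ?thesis
    using metric[OF X sh Y p] g_sh[OF p G.conn_tangent[OF X Y p]] by (simp add: cov1_def cov2_def)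
qed

text \<open>Vanishing torsion trades the bracket for covariant derivatives; the factor 2 compensates
  the \<open>1 / 2\<close> in \<open>ext_deriv\<close>.\<close>

lemma ext_deriv_\<theta>:
  assumes X: "X \<in> vfields A W" and Y: "Y \<in> vfields A W" and p: "p \<in> W"
  shows "2 * ext_deriv A \<theta> X Y p = cov1 A Dg X \<theta> Y p - cov1 A Dg Y \<theta> X p"
  unfolding ext_deriv_def cov1_def torsion[OF X Y p, symmetric]
    \<theta>_diff[OF p G.conn_tangent[OF X Y p] G.conn_tangent[OF Y X p]]
  by simp

context
  fixes p
  assumes p: "p \<in> W" and in_chart: "W \<subseteq> fst (chart_at A p)"
begin

lemmas rank_one = chart_trace_rank_one[OF _ open_W p in_chart]

text \<open>The identity term contributes the dimension. The term with
  \<open>\<theta> p (V p)\<close> contributes one more \<open>\<theta> p (Z p)\<close>, cancelled by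
  the contraction with \<open>sh\<close>, which represents \<open>\<theta>\<close> under
  \<open>g\<close>.\<close>

lemma chart_trace_K:
  assumes Z: "Z \<in> vfields A W"
  shows "chart_trace p (\<lambda>V. K p (V p) (Z p)) = real CARD('m) * \<theta> p (Z p) - S p (\<xi> p) (Z p)"
proof -
  note ZT = tangent[OF Z p]
  have "chart_trace p (\<lambda>V. K p (V p) (Z p)) =
      \<theta> p (Z p) + \<theta> p (Z p) * real CARD('m) - g p (sh p) (Z p) - S p (\<xi> p) (Z p)"
    unfolding K_def chart_trace_diff chart_trace_add
      rank_one[OF tensorial_\<theta>[OF p] Z] chart_trace_const_scaleR chart_trace_identity
      rank_one[OF tensorial_g[OF p ZT] sh] rank_one[OF tensorial_S[OF p ZT] \<xi>] ..
  then show ?thesis using g_sh[OF p ZT] by simp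
qed

text \<open>Only the outer \<open>K\<close> is unfolded. \<open>V\<close> occurs in the inner value
  alone, so the result is the previous trace scaled by \<open>\<theta> p (X p)\<close>, plus three
  endomorphisms with images spanned by \<open>X\<close>, \<open>sh\<close> and
  \<open>\<xi>\<close>.\<close>

lemma chart_trace_K_K:
  assumes X: "X \<in> vfields A W" and Y: "Y \<in> vfields A W"
  shows "chart_trace p (\<lambda>V. K p (X p) (K p (V p) (Y p))) =
    \<theta> p (X p) * (real CARD('m) * \<theta> p (Y p) - S p (\<xi> p) (Y p))
    + \<theta> p (K p (X p) (Y p)) - g p (X p) (K p (sh p) (Y p)) - S p (X p) (K p (\<xi> p) (Y p))"
proof -
  note XT = tangent[OF X p] and YT = tangent[OF Y p]
  note tens = tensorial_pointwise[OF p linear_on_subspace_K[OF _ p YT]]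
  have "chart_trace p (\<lambda>V. K p (X p) (K p (V p) (Y p))) =
      chart_trace p (\<lambda>V. \<theta> p (X p) *\<^sub>R K p (V p) (Y p) + \<theta> p (K p (V p) (Y p)) *\<^sub>R X p
        - g p (X p) (K p (V p) (Y p)) *\<^sub>R sh p - S p (X p) (K p (V p) (Y p)) *\<^sub>R \<xi> p)"
    by (subst K_def) (rule refl)
  then show ?thesis
    unfolding chart_trace_diff chart_trace_add chart_trace_const_scaleR chart_trace_K[OF Y]
      rank_one[OF tens[OF one_form_linear[OF \<theta> p]] X]
      rank_one[OF tens[OF tensor2_linear(1)[OF g p XT]] sh]
      rank_one[OF tens[OF tensor2_linear(1)[OF S p XT]] \<xi>] .
qed

text \<open>The contraction of the first term of \<open>nabla_K\<close> and that of the term with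
  \<open>Dg X sh\<close> cancel by \<open>g_Dg_sh\<close>, so the coefficient of \<open>cov1\<close>
  is exactly the dimension.\<close>

lemma chart_trace_nabla_K_argument:
  assumes X: "X \<in> vfields A W" and Y: "Y \<in> vfields A W"
  shows "chart_trace p (\<lambda>V. nabla_K X V Y p) = real CARD('m) * cov1 A Dg X \<theta> Y p
    - cov2 A Dg X S \<xi> Y p - \<phi> p (X p) * S p (\<xi> p) (Y p)"
proof -
  note YT = tangent[OF Y p]
  have "chart_trace p (\<lambda>V. nabla_K X V Y p) =
      cov1 A Dg X \<theta> Y p + cov1 A Dg X \<theta> Y p * real CARD('m) - g p (Dg X sh p) (Y p)
      - cov2 A Dg X S \<xi> Y p - S p (Dg X \<xi> p) (Y p)"
    unfolding nabla_K_def chart_trace_diff chart_trace_add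
      rank_one[OF G.tensorial_cov1_argument[OF \<theta> X p] Y]
      chart_trace_const_scaleR chart_trace_identity
      rank_one[OF tensorial_g[OF p YT] G.conn_vfields[OF X sh]]
      rank_one[OF G.tensorial_cov2_argument[OF S X Y p] \<xi>]
      rank_one[OF tensorial_S[OF p YT] G.conn_vfields[OF X \<xi>]] ..
  then show ?thesis
    unfolding g_Dg_sh[OF X Y p] Dg_\<xi>[OF X p] S_scaleR(2)[OF p YT tangent[OF \<xi> p]] by simp
qed

lemma chart_trace_nabla_K_direction:
  assumes X: "X \<in> vfields A W" and Y: "Y \<in> vfields A W"
  shows "chart_trace p (\<lambda>V. nabla_K V X Y p) = cov1 A Dg Y \<theta> X p + cov1 A Dg X \<theta> Y p
    - g p (X p) (Y p) * chart_trace p (\<lambda>V. Dg V sh p) - cov2 A Dg \<xi> S X Y p"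
proof -
  \<comment> \<open>The divergence of \<open>\<xi>\<close> is \<open>\<phi> p (\<xi> p)\<close>,
    which vanishes because \<open>Dg \<xi> \<xi> = 0\<close>. Thus \<open>S(X, Y)\<close> times this
    divergence leaves no trace in the formula.\<close>
  have "chart_trace p (\<lambda>V. Dg V \<xi> p) = chart_trace p (\<lambda>V. \<phi> p (V p) *\<^sub>R \<xi> p)"
    by (rule chart_trace_cong[OF open_W in_chart]) (rule Dg_\<xi>[OF _ p])
  also have "\<dots> = \<phi> p (\<xi> p)" by (rule rank_one[OF tensorial_\<phi>[OF p] \<xi>])
  also have "\<dots> = 0"
    using Dg_\<xi>[OF \<xi> p] Dg_\<xi>_\<xi>[OF p] \<xi>_nonzero[OF p] by (metis scaleR_eq_0_iff)
  finally have 0: "chart_trace p (\<lambda>V. Dg V \<xi> p) = 0" .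
  have "chart_trace p (\<lambda>V. nabla_K V X Y p) = cov1 A Dg Y \<theta> X p + cov1 A Dg X \<theta> Y p
      - g p (X p) (Y p) * chart_trace p (\<lambda>V. Dg V sh p) - cov2 A Dg \<xi> S X Y p
      - S p (X p) (Y p) * chart_trace p (\<lambda>V. Dg V \<xi> p)"
    unfolding nabla_K_def chart_trace_diff chart_trace_add
      rank_one[OF G.tensorial_cov1_direction[OF \<theta> X p] Y]
      rank_one[OF G.tensorial_cov1_direction[OF \<theta> Y p] X]
      chart_trace_const_scaleR rank_one[OF G.tensorial_cov2_direction[OF S X Y p] \<xi>] ..
  then show ?thesis unfolding 0 by simp
qed

text \<open>The coefficient of \<open>(D\<^sup>g\<^sub>X \<theta>)(Y)\<close> is
  \<open>-(n + 1) + 1 = -n\<close>, that of \<open>(D\<^sup>g\<^sub>Y \<theta>)(X)\<close> is 1;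
  splitting off \<open>-2 d\<theta>\<close> leaves \<open>1 - n\<close>.
  \<open>\<theta>(K(X, Y))\<close> occurs \<open>(n + 1) - 1 = n\<close> times, so
  \<open>\<theta>(X) \<theta>(Y)\<close> receives \<open>2n - (n + 1) = n - 1\<close>, and
  \<open>g(X, Y) g(sh, sh)\<close> receives \<open>-n\<close>, plus 1 from
  \<open>g(X, K(sh, Y))\<close>. Products of \<open>S\<close> with \<open>\<theta>(X)\<close> or
  \<open>\<theta>(Y)\<close> cancel in pairs, as \<open>S\<close> is symmetric.\<close>

lemma ricci_difference:
  assumes X: "X \<in> vfields A W" and Y: "Y \<in> vfields A W" and n: "CARD('m) = n + 1"
  shows "ricci A D X Y p = ricci A Dg X Y p - 2 * ext_deriv A \<theta> X Y p
    + (1 - real n) * cov1 A Dg X \<theta> Y p + (real n - 1) * \<theta> p (X p) * \<theta> p (Y p)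
    + (1 - real n) * g p (X p) (Y p) * g p (sh p) (sh p)
    - g p (X p) (Y p) * chart_trace p (\<lambda>V. Dg V sh p)
    + ((cov2 A Dg X S \<xi> Y p - cov2 A Dg \<xi> S X Y p) + g p (X p) (Y p) * S p (\<xi> p) (sh p)
       - S p (\<xi> p) (X p) * S p (\<xi> p) (Y p) + \<phi> p (X p) * S p (\<xi> p) (Y p))"
proof -
  note XT = tangent[OF X p] and YT = tangent[OF Y p]
  note \<xi>T = tangent[OF \<xi> p] and shT = tangent[OF sh p]
  have "ricci A D X Y p = chart_trace p (\<lambda>Z. curvature A Dg X Z Y p - nabla_K X Z Y p
      + nabla_K Z X Y p - K p (X p) (K p (Z p) (Y p)) + K p (Z p) (K p (X p) (Y p)))"
    unfolding ricci_eq_chart_trace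
    by (rule chart_trace_cong[OF open_W in_chart]) (rule curvature_difference[OF X _ Y p])
  also have "\<dots> = ricci A Dg X Y p - chart_trace p (\<lambda>Z. nabla_K X Z Y p)
      + chart_trace p (\<lambda>Z. nabla_K Z X Y p) - chart_trace p (\<lambda>Z. K p (X p) (K p (Z p) (Y p)))
      + chart_trace p (\<lambda>Z. K p (Z p) (K_field X Y p))"
    unfolding chart_trace_diff chart_trace_add ricci_eq_chart_trace K_field_def ..
  finally show ?thesis
    unfolding chart_trace_nabla_K_argument[OF X Y] chart_trace_nabla_K_direction[OF X Y]
      chart_trace_K_K[OF X Y] chart_trace_K[OF K_field_vfields[OF X Y]] ext_deriv_\<theta>[OF X Y p]
    unfolding K_field_def \<theta>_K[OF p XT YT] g_K[OF p shT YT XT]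
      S_K[OF p \<xi>T YT XT] S_K[OF p XT YT \<xi>T] g_sh_right[OF p XT] g_sh[OF p YT]
      \<theta>_\<xi>[OF p] g_\<xi>[OF p YT] S_\<xi>[OF p] S_commute[OF p XT \<xi>T]
    using g_sh[OF p shT] n by (simp add: algebra_simps)
qed

end

end

section \<open>The sharp of the Weyl form\<close>

text \<open>The chain rule for a change of chart in the target. It is used to transfer symmetry from
  the ambient metric, where it is stated for tangent vectors only, to the induced one.\<close>

lemma differential_tangent:
  fixes A :: "('a::{t2_space, second_countable_topology}, 'm::finite) chart set"
    and B :: "('b::{t2_space, second_countable_topology}, 'k::finite) chart set"
  assumes "manifold A" "manifold B" "smooth_map A B \<iota>"
  shows "differential A B \<iota> p v \<in> tangent_space B (\<iota> p)"
proof -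
  interpret A: manifold A by fact
  interpret B: manifold B by fact
  define c where "c = chart_at A p"
  have c: "c \<in> A" "p \<in> fst c" by (simp_all add: c_def A.chart_at)
  have deriv: "(snd d \<circ> \<iota> \<circ> chart_inv c has_derivative
      frechet_derivative (snd d \<circ> \<iota> \<circ> chart_inv c) (at (snd c p))) (at (snd c p))"
    if d: "d \<in> B" "\<iota> p \<in> fst d" for d
    by (rule smooth_on_has_derivative[where S = "snd c ` (fst c \<inter> \<iota> -` fst d)"])
      (use assms(3) c d in \<open>auto simp: smooth_map_def\<close>)
  show ?thesis
  proof (rule B.tangent_spaceI)
    fix d e assume de: "d \<in> B" "e \<in> B" "\<iota> p \<in> fst d" "\<iota> p \<in> fst e"
    let ?j = "frechet_derivative (snd e \<circ> chart_inv d) (at (snd d (\<iota> p)))"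
    let ?D = "\<lambda>d. frechet_derivative (snd d \<circ> \<iota> \<circ> chart_inv c) (at (snd c p))"
    have j: "(snd e \<circ> chart_inv d has_derivative ?j) (at ((snd d \<circ> \<iota> \<circ> chart_inv c) (snd c p)))"
      using B.transition_has_derivative[OF de] c by (simp add: A.chart_inv_left)
    have "((snd e \<circ> chart_inv d) \<circ> (snd d \<circ> \<iota> \<circ> chart_inv c) has_derivative ?j \<circ> ?D d) (at (snd c p))"
      by (rule diff_chain_at[OF deriv[OF de(1,3)] j])
    then have "(snd e \<circ> \<iota> \<circ> chart_inv c has_derivative ?j \<circ> ?D d) (at (snd c p))"
    proof (rule has_derivative_transform_within_open)
      have "open (\<iota> -` (fst d \<inter> fst e))"
        using assms(3) by (intro open_vimage open_Int B.chart_open de) (simp add: smooth_map_def)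
      then show "open (snd c ` (fst c \<inter> \<iota> -` (fst d \<inter> fst e)))"
        by (rule A.open_chart_image[OF c(1)])
    qed (use c de in \<open>auto simp: A.chart_inv_left B.chart_inv_left\<close>)
    from frechet_derivative_at[OF this]
    show "differential A B \<iota> p v e = ?j (differential A B \<iota> p v d)"
      using de by (simp add: differential_def c_def[symmetric] Let_def fun_eq_iff)
  qed (unfold differential_def, rule if_not_P)
qed

context manifold
begin

text \<open>In a chart, sending a vector to its \<open>H\<close>-products with the coordinate basis
  is a linear map of \<open>real ^ 'm\<close> to itself; nondegeneracy makes it injective, hence
  surjective.\<close>

lemma nondegenerate_represents:
  assumes H: "\<And>v. v \<in> tangent_space A p \<Longrightarrow> linear_on_subspace (tangent_space A p) (\<lambda>w. H v w)"
      "\<And>v. v \<in> tangent_space A p \<Longrightarrow> linear_on_subspace (tangent_space A p) (\<lambda>w. H w v)"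
    and nondegenerate: "\<And>v. v \<in> tangent_space A p \<Longrightarrow> (\<forall>w\<in>tangent_space A p. H v w = 0) \<Longrightarrow> v = 0"
    and f: "linear_on_subspace (tangent_space A p) f"
  shows "\<exists>!u. u \<in> tangent_space A p \<and> (\<forall>v\<in>tangent_space A p. H u v = f v)"
proof (rule ex_ex1I)
  let ?c = "chart_at A p"
  let ?v = "\<lambda>x. coord_field A ?c x p" and ?b = "\<lambda>i. coord_field A ?c (axis i 1) p"
  have T: "?v x \<in> tangent_space A p" for x by (rule coord_field_tangent[OF chart_at])
  note lin = linear_coord_field[OF chart_at, of p]
  define M where "M x = (\<chi> i. H (?v x) (?b i))" for x
  have "linear M"
    by (rule linearI)
      (simp_all add: M_def vec_eq_iff linear_on_subspace_add[OF H(2)] linear_on_subspace_scaleR[OF H(2)] T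
        linear_add[OF lin] linear_cmul[OF lin] del: plus_fun_apply)
  moreover have "inj M"
  proof (subst linear_injective_0[OF \<open>linear M\<close>], intro allI impI)
    fix x assume "M x = 0"
    then have "H (?v x) (?b i) = 0" for i by (simp add: M_def vec_eq_iff)
    then have "H (?v x) w = 0" if "w \<in> tangent_space A p" for w
      using linear_on_subspace_expansion[OF H(1)[OF T] chart_at that] by simp
    then have "?v x = 0" using nondegenerate[OF T] by blast
    then show "x = 0" using coord_field_self[OF chart_at(1)[of p] chart_at(2)[of p], where u = x] by simp
  qed
  ultimately have "surj M" by (rule linear_injective_imp_surjective) simp
  then obtain x where x: "M x = (\<chi> i. f (?b i))" by (metis surjD)
  have "H (?v x) v = f v" if "v \<in> tangent_space A p" for v
    using linear_on_subspace_expansion[OF H(1)[OF T] chart_at that, of x]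
      linear_on_subspace_expansion[OF f chart_at that] x
    by (simp add: M_def vec_eq_iff)
  then show "\<exists>u. u \<in> tangent_space A p \<and> (\<forall>v\<in>tangent_space A p. H u v = f v)" using T by blast
next
  fix u u' assume u: "u \<in> tangent_space A p \<and> (\<forall>v\<in>tangent_space A p. H u v = f v)"
    "u' \<in> tangent_space A p \<and> (\<forall>v\<in>tangent_space A p. H u' v = f v)"
  then have "u - u' \<in> tangent_space A p" by (intro subspace_diff subspace_tangent_space) auto
  moreover have "\<forall>w\<in>tangent_space A p. H (u - u') w = 0"
    using u linear_on_subspace_diff[OF H(2) subspace_tangent_space] by simp
  ultimately have "u - u' = 0" by (rule nondegenerate)
  then show "u = u'" by simp
qed

text \<open>The smoothness of \<open>\<theta>\<^sup>\<sharp>\<close> comes for free, without inverting a matrix of functions: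
  \<open>g(X, Y) \<theta>\<^sup>\<sharp>\<close> is a combination of \<open>D\<^sub>X Y - D\<^sup>g\<^sub>X Y\<close> and of other smooth fields. Only \<open>g = 0\<close>, that
  is, a one-dimensional manifold, has to be treated separately.\<close>

lemma vfields_nhd_of_multiple:
  assumes W: "open W" "p \<in> W" "W \<subseteq> fst (chart_at A p)" and g: "tensor2 A W g"
    and multiple: "\<And>X Y. X \<in> vfields A W \<Longrightarrow> Y \<in> vfields A W \<Longrightarrow>
      (\<lambda>q. g q (X q) (Y q) *\<^sub>R Z q) \<in> vfields A W"
    and nonzero: "v \<in> tangent_space A p" "w \<in> tangent_space A p" "g p v w \<noteq> 0"
  shows "\<exists>W'. open W' \<and> p \<in> W' \<and> W' \<subseteq> W \<and> Z \<in> vfields A W'"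
proof -
  let ?c = "chart_at A p"
  let ?X = "coord_field A ?c (v ?c)" and ?Y = "coord_field A ?c (w ?c)"
  have XY: "?X \<in> vfields A W" "?Y \<in> vfields A W"
    by (rule coord_field_vfields[OF chart_at(1) W(1,3)])+
  have sm: "smooth_fun A W (\<lambda>q. g q (?X q) (?Y q))" by (rule tensor2_smooth[OF g W(1) XY])
  have "g p (?X p) (?Y p) \<noteq> 0"
    using nonzero(3) unfolding tangent_eq_coord_field[OF chart_at nonzero(1), symmetric]
      tangent_eq_coord_field[OF chart_at nonzero(2), symmetric] .
  then obtain W' where W': "open W'" "W' \<subseteq> W" "p \<in> W'" "\<And>q. q \<in> W' \<Longrightarrow> g q (?X q) (?Y q) \<noteq> 0"
    using smooth_fun_nonzero_nhd[OF W(1) sm W(2)] by blast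
  have "(\<lambda>q. inverse (g q (?X q) (?Y q)) *\<^sub>R (g q (?X q) (?Y q) *\<^sub>R Z q)) \<in> vfields A W'"
    by (rule vfields_scaleR[OF vfields_subset[OF multiple[OF XY] W'(2)]
          smooth_fun_inverse[OF W'(1,4) smooth_fun_subset[OF sm W'(2)]] W'(1)])
  then have "Z \<in> vfields A W'"
    by (rule vfields_cong[OF _ W'(1)]) (simp add: W'(4) del: scaleR_left_imp_eq)
  then show ?thesis using W' by blast
qed

end

section \<open>Metrics of the conformal class, and the one-dimensional case\<close>

lemma tensor2_conformal_class:
  assumes A: "manifold A" and g0: "tensor2 A UNIV g0" and g: "g \<in> conformal_class A g0"
  shows "tensor2 A UNIV g"
proof -
  interpret manifold A by fact
  obtain f where f: "smooth_fun A UNIV f" and g_eq: "g = (\<lambda>p v w. exp (- 2 * f p) * g0 p v w)"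
    using g unfolding conformal_class_def by blast
  have ef: "smooth_fun A UNIV (\<lambda>p. exp (- 2 * f p))"
    by (intro smooth_fun_exp smooth_fun_mult smooth_fun_const f open_UNIV)
  have lin: "linear_on_subspace T (\<lambda>v. a * h v)" if "linear_on_subspace T h" for T h a
    using that unfolding linear_on_subspace_def by (simp add: algebra_simps)
  show ?thesis
    unfolding tensor2_def g_eq
  proof (intro conjI ballI allI impI)
    fix p v assume v: "v \<in> tangent_space A p"
    show "linear_on_subspace (tangent_space A p) (\<lambda>w. exp (- 2 * f p) * g0 p v w)"
      "linear_on_subspace (tangent_space A p) (\<lambda>w. exp (- 2 * f p) * g0 p w v)"
      by (rule lin[OF tensor2_linear(1)[OF g0 UNIV_I v]] lin[OF tensor2_linear(2)[OF g0 UNIV_I v]])+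
  next
    fix V X Y assume V: "open V \<and> V \<subseteq> UNIV \<and> X \<in> vfields A V \<and> Y \<in> vfields A V"
    then show "smooth_fun A V (\<lambda>p. exp (- 2 * f p) * g0 p (X p) (Y p))"
      using smooth_fun_mult[OF _ smooth_fun_subset[OF ef subset_UNIV]
          tensor2_smooth[OF tensor2_subset[OF g0 subset_UNIV]]] by blast
  qed
qed

lemma lightlike_hypersurface_symmetric:
  assumes "lightlike_hypersurface n A B h \<iota> g0"
  shows "symmetric2 A UNIV g0"
proof -
  have "manifold A" "manifold B" "smooth_map A B \<iota>" "symmetric2 B UNIV h"
    using assms unfolding lightlike_hypersurface_def immersion_def lorentzian_metric_def
    by (simp_all add: manifold_def)
  with differential_tangent[OF this(1-3)] show ?thesis
    using assms unfolding lightlike_hypersurface_def symmetric2_def by simp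
qed

text \<open>With a single coordinate index, comparing components shows every tangent vector to be a
  multiple of the nonzero \<open>\<xi>\<close>.\<close>

lemma (in manifold) form_vanishes_in_dimension_one:
  assumes dim: "\<And>i j :: 'm. i = j"
    and \<xi>: "\<xi> \<in> tangent_space A q" "\<xi> \<noteq> 0" and f: "linear_on_subspace (tangent_space A q) f" "f \<xi> = 0"
    and v: "v \<in> tangent_space A q"
  shows "f v = 0"
proof -
  let ?d = "chart_at A q"
  have "\<xi> ?d \<noteq> 0"
    using tangent_eqI[OF chart_at \<xi>(1) subspace_0[OF subspace_tangent_space]] \<xi>(2) by auto
  then obtain i where i: "\<xi> ?d $ i \<noteq> 0" by (auto simp: vec_eq_iff)
  define a where "a = v ?d $ i / \<xi> ?d $ i"
  have "v ?d $ j = (a *\<^sub>R \<xi>) ?d $ j" for j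
    using i unfolding dim[of j i] a_def by (simp add: scaleR_fun_def)
  then have "v = a *\<^sub>R \<xi>"
    by (intro tangent_eqI[OF chart_at v subspace_scale[OF subspace_tangent_space \<xi>(1)]])
      (simp add: vec_eq_iff)
  then show ?thesis using linear_on_subspace_scaleR[OF f(1) \<xi>(1)] f(2) by simp
qed

text \<open>For distinct indices \<open>f(b j) b i - f(b i) b j\<close> lies in the kernel of
  \<open>f\<close>; if it were 0, then \<open>f(b j) = 0\<close> and so \<open>b j = 0\<close>,
  which is absurd.\<close>

lemma (in manifold) dimension_one_of_injective_form:
  assumes f: "linear_on_subspace (tangent_space A p) f"
    and inj: "\<And>v. v \<in> tangent_space A p \<Longrightarrow> f v = 0 \<Longrightarrow> v = 0"
  shows "i = (j :: 'm)"
proof (rule ccontr)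
  assume "i \<noteq> j"
  let ?c = "chart_at A p"
  let ?b = "\<lambda>i. coord_field A ?c (axis i 1) p"
  have b: "?b i \<in> tangent_space A p" "?b i ?c = axis i 1" for i
    using coord_field_tangent[OF chart_at] coord_field_self[OF chart_at] by blast+
  let ?v = "f (?b j) *\<^sub>R ?b i - f (?b i) *\<^sub>R ?b j"
  have "?v \<in> tangent_space A p"
    by (intro subspace_diff subspace_scale subspace_tangent_space b)
  moreover have "f ?v = 0"
    using linear_on_subspace_diff[OF f subspace_tangent_space] linear_on_subspace_scaleR[OF f]
      subspace_scale[OF subspace_tangent_space] b(1) by simp
  ultimately have "?v ?c $ i = 0" using inj by (metis zero_fun_apply zero_index)
  then have "f (?b j) = 0" using \<open>i \<noteq> j\<close> b(2) by (simp add: scaleR_fun_def axis_def)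
  then have "?b j = 0" using inj b(1) by blast
  then show False using b(2)[of j] by (simp add: axis_eq_0_iff)
qed

theorem proposition3p2:
  fixes A :: "('a::{t2_space, second_countable_topology}, 'm::finite) chart set"
    and B :: "('b::{t2_space, second_countable_topology}, 'k::finite) chart set"
    and n :: nat
    and gbar :: "('b, 'k) tens2" and Dbar :: "('b, 'k) conn" and \<iota> :: "'a \<Rightarrow> 'b"
    and g0 g C S :: "('a, 'm) tens2" and \<theta> \<eta> \<phi> :: "('a, 'm) form1"
    and Scr :: "'a \<Rightarrow> ('a, 'm) tvec set"
    and D Dg Dstar :: "('a, 'm) conn"
    and \<xi> X Y :: "('a, 'm) vfield" and E :: "'m \<Rightarrow> ('a, 'm) vfield"
    and U V :: "'a set" and p :: 'a
  assumes "lightlike_hypersurface n A B gbar \<iota> g0"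
    and "levi_civita B gbar Dbar"
    and "totally_geodesic A B gbar Dbar \<iota> g0"
    and "screen_distribution n A g0 Scr"
    and "integrable_distribution A Scr"
    and "weyl_screen_structure A g0 Scr D"
    and "screen_normal_section A U g0 Scr D \<xi> \<eta>"
    and "g \<in> conformal_class A g0"
    and "weyl_form A D g \<theta>"
    and "metric_connection_data A U g0 Scr D \<xi> \<eta> g \<theta> Dg Dstar C S \<phi>"
    and "X \<in> vfields A U" and "Y \<in> vfields A U"
    and "local_frame A V E" and "V \<subseteq> U" and "p \<in> V"
  shows "ricci A D X Y p =
      ricci A Dg X Y p - 2 * ext_deriv A \<theta> X Y p
      + (1 - real n) * cov1 A Dg X \<theta> Y p
      + (real n - 1) * \<theta> p (X p) * \<theta> p (Y p)
      + (1 - real n) * g p (X p) (Y p) * g p (sharp A g \<eta> \<theta> p) (sharp A g \<eta> \<theta> p)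
      - g p (X p) (Y p) * divergence g \<eta> Dg E (sharp A g \<eta> \<theta>) p
      + ((cov2 A Dg X S \<xi> Y p - cov2 A Dg \<xi> S X Y p)
         + g p (X p) (Y p) * S p (\<xi> p) (sharp A g \<eta> \<theta> p)
         - S p (\<xi> p) (X p) * S p (\<xi> p) (Y p)
         + \<phi> p (X p) * S p (\<xi> p) (Y p))"
proof -
  interpret manifold A
    using assms(1) by (simp add: manifold_def lightlike_hypersurface_def)
  note hyp = assms(1)[unfolded lightlike_hypersurface_def]
  have U: "open U" and \<xi>U: "\<xi> \<in> vfields A U" and \<eta>: "one_form A U \<eta>"
    and \<xi>_props: "\<And>q. q \<in> U \<Longrightarrow> \<xi> q \<in> radical A g0 q \<and> \<xi> q \<noteq> 0 \<and> D \<xi> \<xi> q = 0 \<and>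
        \<eta> q (\<xi> q) = 1 \<and> {v\<in>tangent_space A q. \<eta> q v = 0} = Scr q"
    using assms(7) unfolding screen_normal_section_def by blast+
  note data = assms(10)[unfolded metric_connection_data_def]
  have Dg: "connection A U Dg" "torsion_free A U Dg" "parallel2 A U Dg g"
    and Dg\<xi>\<xi>: "\<And>q. q \<in> U \<Longrightarrow> Dg \<xi> \<xi> q = 0"
    and S: "tensor2 A U S" "symmetric2 A U S" "\<And>q. q \<in> U \<Longrightarrow> S q (\<xi> q) (\<xi> q) = 0"
    using data by simp_all
  have diff: "D X Y q = Dg X Y q + \<theta> q (X q) *\<^sub>R Y q + \<theta> q (Y q) *\<^sub>R X q
        - g q (X q) (Y q) *\<^sub>R sharp A g \<eta> \<theta> q - S q (X q) (Y q) *\<^sub>R \<xi> q"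
    and Dg\<xi>: "Dg X \<xi> q = \<phi> q (X q) *\<^sub>R \<xi> q"
    if "open V" "V \<subseteq> U" "X \<in> vfields A V" "Y \<in> vfields A V" "q \<in> V" for V X Y q
    using data that by metis+
  have D: "connection A UNIV D"
    using assms(6) by (simp add: weyl_screen_structure_def weyl_structure_def)
  have \<theta>: "one_form A UNIV \<theta>" using assms(9) by (simp add: weyl_form_def)
  have g: "tensor2 A UNIV g"
    by (rule tensor2_conformal_class[OF _ _ assms(8)]) (use hyp manifold_axioms in simp_all)
  obtain f where g_eq: "g = (\<lambda>p v w. exp (- 2 * f p) * g0 p v w)"
    using assms(8) unfolding conformal_class_def by blast
  have g_sym: "g q v w = g q w v" if "v \<in> tangent_space A q" "w \<in> tangent_space A q" for q v w
    using lightlike_hypersurface_symmetric[OF assms(1)] that by (simp add: g_eq symmetric2_def)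
  \<comment> \<open>The conformal factor is positive, so \<open>g\<close> and \<open>g0\<close> have
    the same radical.\<close>
  have radical: "v \<in> radical A g0 q \<longleftrightarrow>
      v \<in> tangent_space A q \<and> (\<forall>w\<in>tangent_space A q. g q v w = 0)" for q v
    by (simp add: radical_def g_eq)
  have \<xi>T: "\<xi> q \<in> tangent_space A q" and g\<xi>: "\<And>v. v \<in> tangent_space A q \<Longrightarrow> g q (\<xi> q) v = 0"
    if "q \<in> U" for q
    using \<xi>_props[OF that] radical by blast+
  \<comment> \<open>Such a vector lies in the screen, which is the kernel of \<open>\<eta>\<close>,
    and also in the radical; the two are complementary.\<close>
  have kernel: "v = 0"
    if q: "q \<in> U" and v: "v \<in> tangent_space A q" "\<eta> q v = 0" "\<forall>w\<in>tangent_space A q. g q v w = 0" for q v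
  proof -
    have "v \<in> Scr q \<inter> radical A g0 q" using \<xi>_props[OF q] v radical by blast
    then show ?thesis using assms(4) unfolding screen_distribution_def by auto
  qed
  define H where "H q = gtilde g \<eta> q" for q
  have H_eq: "H q v w = g q v w + \<eta> q v * \<eta> q w" for q v w by (simp add: H_def gtilde_def)
  have lin_add: "linear_on_subspace T (\<lambda>v. a v + b * c v)"
    if "linear_on_subspace T a" "linear_on_subspace T c" for T a b c
    using that unfolding linear_on_subspace_def by (simp add: algebra_simps)
  have H_lin: "linear_on_subspace (tangent_space A q) (\<lambda>w. H q v w)"
    if "q \<in> U" "v \<in> tangent_space A q" for q v
    unfolding H_eq
    by (rule lin_add[OF tensor2_linear(1)[OF g UNIV_I that(2)] one_form_linear[OF \<eta> that(1)]])
  have H_sym: "H q v w = H q w v" if "v \<in> tangent_space A q" "w \<in> tangent_space A q" for q v w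
    unfolding H_eq by (simp add: g_sym[OF that])
  have H_lin': "linear_on_subspace (tangent_space A q) (\<lambda>w. H q w v)"
    if "q \<in> U" "v \<in> tangent_space A q" for q v
    unfolding H_eq mult.commute[of _ "\<eta> q v"]
    by (rule lin_add[OF tensor2_linear(2)[OF g UNIV_I that(2)] one_form_linear[OF \<eta> that(1)]])
  have H_\<xi>: "H q v (\<xi> q) = \<eta> q v" if "q \<in> U" "v \<in> tangent_space A q" for q v
    using \<xi>_props[OF that(1)] g\<xi>[OF that] g_sym[OF that(2) \<xi>T[OF that(1)]] by (simp add: H_eq)
  \<comment> \<open>Testing against \<open>\<xi>\<close>, where \<open>g\<close> vanishes and
    \<open>\<eta>\<close> is 1, gives \<open>\<eta> q v = 0\<close>; then \<open>H\<close> reduces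
    to \<open>g\<close>.\<close>
  have H_nondegenerate: "v = 0"
    if q: "q \<in> U" and v: "v \<in> tangent_space A q" "\<forall>w\<in>tangent_space A q. H q v w = 0" for q v
  proof (rule kernel[OF q v(1)])
    show "\<eta> q v = 0" using H_\<xi>[OF q v(1)] v(2) \<xi>T[OF q] by simp
    then show "\<forall>w\<in>tangent_space A q. g q v w = 0" using v(2) by (simp add: H_eq)
  qed
  define sh where "sh = sharp A g \<eta> \<theta>"
  have sh: "sh q \<in> tangent_space A q" "\<And>v. v \<in> tangent_space A q \<Longrightarrow> H q (sh q) v = \<theta> q v"
    if q: "q \<in> U" for q
  proof -
    have "\<exists>!u. u \<in> tangent_space A q \<and> (\<forall>v\<in>tangent_space A q. H q u v = \<theta> q v)"
      by (rule nondegenerate_represents[OF H_lin[OF q] H_lin'[OF q] H_nondegenerate[OF q]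
            one_form_linear[OF \<theta> UNIV_I]])
    from theI'[OF this] show "sh q \<in> tangent_space A q"
      "\<And>v. v \<in> tangent_space A q \<Longrightarrow> H q (sh q) v = \<theta> q v"
      by (simp_all add: sh_def sharp_def H_def)
  qed
  have \<theta>\<xi>: "\<theta> q (\<xi> q) = 0" if q: "q \<in> U" for q
  proof -
    have "(2 * \<theta> q (\<xi> q)) *\<^sub>R \<xi> q = 0"
      using diff[OF U subset_refl \<xi>U \<xi>U q] \<xi>_props[OF q] Dg\<xi>\<xi>[OF q] S(3)[OF q] g\<xi>[OF q \<xi>T[OF q]]
      by (simp only: mult_2 scaleR_add_left) simp
    then show ?thesis using \<xi>_props[OF q] by (simp only: scaleR_eq_0_iff) simp
  qed
  \<comment> \<open>\<open>\<eta>(sh) = H(sh, \<xi>) = \<theta>(\<xi>) = 0\<close>, so the extra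
    term of \<open>H\<close> over \<open>g\<close> disappears on \<open>sh\<close>.\<close>
  have g_sh: "g q (sh q) v = \<theta> q v" if "q \<in> U" "v \<in> tangent_space A q" for q v
    using sh(2)[OF that] sh(2)[OF that(1) \<xi>T[OF that(1)]] H_\<xi>[OF that(1) sh(1)[OF that(1)]]
      \<theta>\<xi>[OF that(1)] by (simp add: H_eq)
  let ?W = "V \<inter> fst (chart_at A p)"
  have V: "open V" "\<And>\<alpha>. E \<alpha> \<in> vfields A V" "inj (\<lambda>\<alpha>. E \<alpha> p)" "independent (range (\<lambda>\<alpha>. E \<alpha> p))"
    using assms(13,15) unfolding local_frame_def by blast+
  have W: "open ?W" "p \<in> ?W" "?W \<subseteq> U" and p: "p \<in> U"
    using V(1) assms(14,15) chart_at by (auto intro: open_Int chart_open)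
  have "\<exists>W'. open W' \<and> p \<in> W' \<and> W' \<subseteq> ?W \<and> sh \<in> vfields A W'"
  proof (cases "\<exists>v\<in>tangent_space A p. \<exists>w\<in>tangent_space A p. g p v w \<noteq> 0")
    case True
    then obtain v w where vw: "v \<in> tangent_space A p" "w \<in> tangent_space A p" "g p v w \<noteq> 0" by blast
    interpret D: open_connection A ?W D
      using W(1) connection_subset[OF D subset_UNIV] by unfold_locales
    interpret Dg: open_connection A ?W Dg
      using W(1) connection_subset[OF Dg(1) W(3)] by unfold_locales
    show ?thesis
    proof (rule vfields_nhd_of_multiple[OF W(1,2) Int_lower2 tensor2_subset[OF g subset_UNIV] _ vw])
      fix X Y assume X: "X \<in> vfields A ?W" and Y: "Y \<in> vfields A ?W"
      have S_sm: "smooth_fun A ?W (\<lambda>q. S q (X q) (Y q))"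
        by (rule tensor2_smooth[OF tensor2_subset[OF S(1) W(3)] W(1) X Y])
      note \<theta>_sm = one_form_smooth[OF one_form_subset[OF \<theta> subset_UNIV] W(1)]
      have "Dg X Y + (\<lambda>q. \<theta> q (X q) *\<^sub>R Y q) + (\<lambda>q. \<theta> q (Y q) *\<^sub>R X q)
          - (\<lambda>q. S q (X q) (Y q) *\<^sub>R \<xi> q) - D X Y \<in> vfields A ?W" (is "?Z \<in> _")
        by (intro vfields_diff vfields_add W(1) Dg.conn_vfields D.conn_vfields X Y
            vfields_scaleR[OF Y \<theta>_sm[OF X]] vfields_scaleR[OF X \<theta>_sm[OF Y]]
            vfields_scaleR[OF vfields_subset[OF \<xi>U W(3)] S_sm])
      then show "(\<lambda>q. g q (X q) (Y q) *\<^sub>R sh q) \<in> vfields A ?W"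
      proof (rule vfields_cong[OF _ W(1)])
        fix q assume "q \<in> ?W"
        from diff[OF W(1,3) X Y this] show "?Z q = g q (X q) (Y q) *\<^sub>R sh q"
          by (simp add: sh_def fun_eq_iff)
      qed
    qed
  next
    case False
    \<comment> \<open>If \<open>g\<close> is 0 at \<open>p\<close>, then \<open>kernel\<close> makes
      \<open>\<eta>\<close> injective there, which forces dimension one. Then \<open>\<xi>\<close>
      spans each tangent space over \<open>U\<close>, so \<open>\<theta>\<close> and with it
      \<open>sh\<close> vanish on \<open>U\<close>.\<close>
    have dim: "i = j" for i j :: 'm
      by (rule dimension_one_of_injective_form[OF one_form_linear[OF \<eta> p]]) (use kernel[OF p] False in blast)
    have "sh q = 0" if q: "q \<in> U" for q
    proof (rule H_nondegenerate[OF q sh(1)[OF q]], rule ballI)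
      fix w assume w: "w \<in> tangent_space A q"
      have "\<theta> q w = 0"
        by (rule form_vanishes_in_dimension_one[OF dim \<xi>T[OF q] _ one_form_linear[OF \<theta> UNIV_I] \<theta>\<xi>[OF q] w])
          (use \<xi>_props[OF q] in blast)
      then show "H q (sh q) w = 0" using sh(2)[OF q w] by simp
    qed
    then have "sh \<in> vfields A ?W"
      by (intro vfields_cong[OF vfields_zero[OF W(1)] W(1)]) (use W(3) in auto)
    then show ?thesis using W by blast
  qed
  \<comment> \<open>One neighbourhood for all demands: inside the chart domain for the traces,
    inside \<open>V\<close> for the frame, inside \<open>U\<close> for the connection data, and with
    \<open>sh\<close> smooth on it.\<close>
  then obtain W' where W': "open W'" "p \<in> W'" "W' \<subseteq> ?W" "sh \<in> vfields A W'" by blast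
  have W'U: "W' \<subseteq> U" and in_chart: "W' \<subseteq> fst (chart_at A p)" and W'V: "W' \<subseteq> V"
    using W'(3) W(3) by blast+
  note in_U = subsetD[OF W'U]
  interpret weyl_difference A W' D Dg \<theta> \<phi> g S \<xi> sh
  proof unfold_locales
    show "connection A W' D" "connection A W' Dg"
      using connection_subset[OF D subset_UNIV] connection_subset[OF Dg(1) W'U] .
    show "one_form A W' \<theta>" "tensor2 A W' g" "tensor2 A W' S"
      using one_form_subset[OF \<theta> subset_UNIV] tensor2_subset[OF g subset_UNIV]
        tensor2_subset[OF S(1) W'U] .
    show "symmetric2 A W' g" using g_sym by (simp add: symmetric2_def)
    show "symmetric2 A W' S" using S(2) in_U by (simp add: symmetric2_def)
    show "\<xi> \<in> vfields A W'" by (rule vfields_subset[OF \<xi>U W'U])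
  next
    fix X Y q assume XY: "X \<in> vfields A W'" "Y \<in> vfields A W'" and q: "q \<in> W'"
    show "Dg X Y q - Dg Y X q = lie_bracket A X Y q"
      using Dg(2) W'(1) W'U XY q unfolding torsion_free_def by blast
    show "D X Y q = Dg X Y q + \<theta> q (X q) *\<^sub>R Y q + \<theta> q (Y q) *\<^sub>R X q
        - g q (X q) (Y q) *\<^sub>R sh q - S q (X q) (Y q) *\<^sub>R \<xi> q"
      unfolding sh_def by (rule diff[OF W'(1) W'U XY q])
  next
    fix X q assume "X \<in> vfields A W'" "q \<in> W'"
    then show "Dg X \<xi> q = \<phi> q (X q) *\<^sub>R \<xi> q" using Dg\<xi>[OF W'(1) W'U] by blast
  next
    fix X Y Z q assume "X \<in> vfields A W'" "Y \<in> vfields A W'" "Z \<in> vfields A W'" "q \<in> W'"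
    then show "cov2 A Dg X g Y Z q = 0"
      using Dg(3) W'(1) W'U unfolding parallel2_def by blast
  qed (use W' \<xi>_props g\<xi> g_sh \<theta>\<xi> S(3) Dg\<xi>\<xi> in_U in auto)
  \<comment> \<open>The inverse coefficients in the divergence are those of \<open>gtilde\<close>,
    so the frame formula is applied with \<open>H\<close> as the nondegenerate form and
    \<open>Z \<mapsto> Dg Z sh\<close> as the endomorphism.\<close>
  have "divergence g \<eta> Dg E sh p = chart_trace p (\<lambda>Z. Dg Z sh p)"
    unfolding divergence_def inv_metric_def
    by (rule chart_trace_frame[OF G.tensorial_conn[OF W'(4,2)] G.conn_tangent[OF _ W'(4,2)]
          W'(1,2) in_chart vfields_subset[OF V(2) W'V] V(3,4)
          H_lin[OF p, unfolded H_def] H_sym[unfolded H_def]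
          H_nondegenerate[OF p, unfolded H_def], symmetric])
  then show ?thesis
    using ricci_difference[OF W'(2) in_chart vfields_subset[OF assms(11) W'U]
        vfields_subset[OF assms(12) W'U], of n] hyp
    by (simp add: sh_def)
qed

end
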